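(* Suppose that $\mathbb{P}$ is $\psi$-mixing and let $\Gamma>0$ be a constant with $\mathbb{P}(A)\le e^{-\Gamma n}$ for all $n\ge1$ and $A\in\mathcal{C}_n$ (such a constant exists by $\psi$-mixing). Then for any $n\geq 1$, any $A\in\mathcal{C}_n$ with $\mathbb{P}(A)>0$ and any $t\ge0$, $$\big|\mathbb{P}\{(\mathbb{P}(A))^\ell\tau_A>t\}-e^{-(1-\rho_A)t}\big|\le 2^{2\ell+8}(1+\psi_0)^{2\ell}(t+1)\Big(\psi_n(1-e^{-\Gamma})^{-1}+d_\ell\ell^2n^4(1+t^{-1})e^{-\Gamma n/(d_\ell+6)}\Big)+2\wp\Big(2^\ell t\psi_n+10e^{-\Gamma n/2}(1+\psi_0)^{2\ell}d_\ell n^2(t+1)\Big),$$ provided $\psi_n<(3/2)^{1/(\ell+1)}-1$ (for $t=0$ the right-hand side is understood as $+\infty$).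
   Context: $\mathbb{N}=\{0,1,2,\dots\}$; $[x]$ is the integral part of a number $x$; $\wp(x)=xe^x$. $\mathcal{A}$ is a finite or countable alphabet with more than one element, $\Omega=\mathcal{A}^{\mathbb{N}}$, $\mathcal{F}$ is the $\sigma$-algebra generated by cylinder sets, $T$ is the left shift $(T\omega)_i=\omega_{i+1}$, and $\mathbb{P}$ is a $T$-invariant probability on $(\Omega,\mathcal{F})$ such that every cylinder $[a]=\{\omega:\omega_0=a\}$, $a\in\mathcal{A}$, has positive probability. For $0\le k\le n\le\infty$, $\mathcal{F}_{k,n}$ is the $\sigma$-algebra generated by the coordinates $\omega_i$ with $k\le i\le n$ (all $i\geq k$ if $n=\infty$). For $\sigma$-algebras $\mathcal{G},\mathcal{H}\subset\mathcal{F}$, $$\psi(\mathcal{G},\mathcal{H})=\sup\Big\{\Big|\frac{\mathbb{P}(B\cap C)}{\mathbb{P}(B)\mathbb{P}(C)}-1\Big|:B\in\mathcal{G},\,C\in\mathcal{H},\ \mathbb{P}(B)\mathbb{P}(C)\neq0\Big\},\qquad \psi_m=\sup_{n\in\mathbb{N}}\psi(\mathcal{F}_{0,n},\mathcal{F}_{n+m+1,\infty}).$$ $\mathbb{P}$ is called $\psi$-mixing if $\psi_0<\infty$ and $\psi_m\to0$ as $m\to\infty$. $\mathcal{C}_n$ is the set of all $n$-cylinders $[a_0,\dots,a_{n-1}]=\{\omega\in\Omega:\omega_i=a_i,\ 0\le i\le n-1\}$. For $A\in\mathcal{C}_n$, $\pi(A)=\min\{k\in\{1,\dots,n\}:A\cap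 T^{-k}A\ne\emptyset\}$. Let $\ell\ge1$ and $q_i(k)=d_ik$, $i=1,\dots,\ell$, with integers $1\le d_1<d_2<\cdots<d_\ell$. For $A\in\mathcal{C}_n$, $$\tau_A(\omega)=\min\Big\{k\ge1:\prod_{i=1}^\ell\mathbb{I}_A(T^{d_ik}\omega)=1\Big\}$$ (equal to $+\infty$ if there is no such $k$). For $R=[a_0,\dots,a_{r-1}]\in\mathcal{C}_r$ and an integer $n\ge r$, $$R^{n/r}=\Big(\bigcap_{k=0}^{[n/r]-1}T^{-kr}R\Big)\cap T^{-r[n/r]}\big([a_0,\dots,a_{n-r[n/r]-1}]\big),$$ where the last cylinder is $\Omega$ if $r$ divides $n$; thus $R^{n/r}$ is the $n$-cylinder obtained by repeating $a_0,\dots,a_{r-1}$ periodically. For $A=[a_0,\dots,a_{n-1}]\in\mathcal{C}_n$ with $\mathbb{P}(A)>0$ put $r=\pi(A)$, $R=[a_0,\dots,a_{r-1}]$, $$\kappa=\mathrm{lcm}\Big\{\frac{r}{\gcd\{r,d_i\}}:1\le i\le\ell\Big\},\qquad \rho_A=\prod_{i=1}^\ell\mathbb{P}\big(R^{(n+d_i\kappa)/r}\,\big|\,A\big).$$ *)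

theory Defs
  imports "HOL-Probability.Probability"
begin

text \<open>
  The alphabet is the type \<open>'a :: countable\<close> (finite or countably infinite) and the sequence
  space is the whole type \<open>nat \<Rightarrow> 'a\<close>.
\<close>

definition shift :: "(nat \<Rightarrow> 'a) \<Rightarrow> nat \<Rightarrow> 'a" where
  "shift \<omega> = (\<lambda>i. \<omega> (Suc i))"

definition cylinder :: "'a list \<Rightarrow> (nat \<Rightarrow> 'a) set" where
  "cylinder a = {\<omega>. \<forall>i<length a. \<omega> i = a ! i}"

definition cylinders :: "nat \<Rightarrow> (nat \<Rightarrow> 'a) set set" where
  "cylinders n = {cylinder a | a. length a = n}"

definition coord_algebra :: "nat \<Rightarrow> enat \<Rightarrow> (nat \<Rightarrow> 'a) set set" where
  "coord_algebra k n = sigma_sets UNIV {{\<omega>. \<omega> i \<in> S} | i S. k \<le> i \<and> enat i \<le> n}"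

definition psi_dep :: "'b measure \<Rightarrow> 'b set set \<Rightarrow> 'b set set \<Rightarrow> ennreal" where
  "psi_dep M G H =
     (SUP (B, C) \<in> {(B, C). B \<in> G \<and> C \<in> H \<and> measure M B * measure M C \<noteq> 0}.
        ennreal \<bar>measure M (B \<inter> C) / (measure M B * measure M C) - 1\<bar>)"

definition psi_coeff :: "(nat \<Rightarrow> 'a) measure \<Rightarrow> nat \<Rightarrow> ennreal" where
  "psi_coeff M m =
     (SUP n. psi_dep M (coord_algebra 0 (enat n)) (coord_algebra (n + m + 1) \<infinity>))"

definition psi_mixing :: "(nat \<Rightarrow> 'a) measure \<Rightarrow> bool" where
  "psi_mixing M \<longleftrightarrow> psi_coeff M 0 < \<infinity> \<and> psi_coeff M \<longlonglongrightarrow> 0"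

text \<open>
  The coefficients decrease in \<open>m\<close>, so for a \<open>\<psi>\<close>-mixing measure all of them are finite and
  the following conversion to \<open>real\<close> loses nothing.
\<close>

definition psi :: "(nat \<Rightarrow> 'a) measure \<Rightarrow> nat \<Rightarrow> real" where
  "psi M m = enn2real (psi_coeff M m)"

definition first_return :: "nat \<Rightarrow> (nat \<Rightarrow> 'a) set \<Rightarrow> nat" where
  "first_return n A = Min {k \<in> {1..n}. A \<inter> (shift ^^ k) -` A \<noteq> {}}"

text \<open>The infimum of the empty set in \<open>enat\<close> is \<open>\<infinity>\<close>; a nonempty set has a minimum.\<close>

definition hitting_time ::
    "nat \<Rightarrow> (nat \<Rightarrow> nat) \<Rightarrow> (nat \<Rightarrow> 'a) set \<Rightarrow> (nat \<Rightarrow> 'a) \<Rightarrow> enat" where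
  "hitting_time l d A \<omega> =
     Inf {enat k | k. 1 \<le> k \<and> (\<Prod>i=1..l. indicator A ((shift ^^ (d i * k)) \<omega>)) = (1 :: nat)}"

text \<open>
  For \<open>a\<close> of length \<open>r\<close> and \<open>m \<ge> r\<close>, this is the \<open>m\<close>-cylinder \<open>R\<^bsup>m/r\<^esup>\<close> with
  \<open>R = cylinder a\<close>. If \<open>r\<close> divides \<open>m\<close>, the last word is empty and its cylinder is everything.
\<close>

definition periodic_cylinder :: "'a list \<Rightarrow> nat \<Rightarrow> (nat \<Rightarrow> 'a) set" where
  "periodic_cylinder a m = (let r = length a; q = m div r in
     (\<Inter>k\<in>{..<q}. (shift ^^ (k * r)) -` cylinder a) \<inter>
     (shift ^^ (r * q)) -` cylinder (take (m - r * q) a))"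

definition kappa :: "nat \<Rightarrow> (nat \<Rightarrow> nat) \<Rightarrow> nat \<Rightarrow> nat" where
  "kappa l d r = Lcm ((\<lambda>i. r div gcd r (d i)) ` {1..l})"

definition rho :: "(nat \<Rightarrow> 'a) measure \<Rightarrow> nat \<Rightarrow> (nat \<Rightarrow> nat) \<Rightarrow> 'a list \<Rightarrow> real" where
  "rho M l d a = (let n = length a; A = cylinder a; r = first_return n A in
     \<Prod>i=1..l. cond_prob M
       (\<lambda>\<omega>. \<omega> \<in> periodic_cylinder (take r a) (n + d i * kappa l d r)) (\<lambda>\<omega>. \<omega> \<in> A))"

definition wp :: "real \<Rightarrow> real" where
  "wp x = x * exp x"

end

theory Submission
  imports Defs
begin

text \<open>
  Put \<open>p = \<P>(A)\<close> and say that \<open>k\<close> is a hit if \<open>A\<close> occurs at all the positions \<open>d i * k\<close>; the event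
  in question is that there is no hit up to \<open>N = \<lfloor>t / p\<^sup>l\<rfloor>\<close>. Hits come in clumps with spacing \<open>\<kappa>\<close>, so
  the first hit is, up to small errors, the start of a clump: a hit \<open>m\<close> such that \<open>m - \<kappa>\<close> is not a
  hit. Let \<open>S m\<close> be the probability of no hit up to \<open>m\<close>. All but \<open>O(l\<^sup>2 d\<^sub>l n)\<close> of the earlier times
  \<open>j\<close> have their windows at a distance of at least \<open>n\<close> from those of \<open>m\<close> and \<open>m - \<kappa>\<close>; the event of no
  hit at such \<open>j\<close> is almost independent of a clump start at \<open>m\<close>, by \<open>\<psi>\<close>-mixing applied to the \<open>l\<close>
  windows one after the other. The remaining times are negligible: a clump start and a nearby hit
  exclude each other by a Fine--Wilf argument, or their joint probability has an extra factor
  \<open>exp (- \<Gamma> n / 2)\<close>. Hence \<open>S m\<close> is close to \<open>(1 - (1 - \<rho>) p\<^sup>l) S (m - 1)\<close>, and iteration gives the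
  exponential law.
\<close>

section \<open>Events determined by finitely many coordinates\<close>

definition depends_on :: "nat set \<Rightarrow> (nat \<Rightarrow> 'a) set \<Rightarrow> bool" where
  "depends_on J E \<longleftrightarrow> (\<forall>\<omega> \<omega>'. (\<forall>i\<in>J. \<omega> i = \<omega>' i) \<longrightarrow> \<omega> \<in> E \<longrightarrow> \<omega>' \<in> E)"

text \<open>The defining condition is symmetric in the two sequences, which gives the
  equivalence.\<close>

lemma depends_onD:
  "depends_on J E \<Longrightarrow> (\<And>i. i \<in> J \<Longrightarrow> \<omega> i = \<omega>' i) \<Longrightarrow> \<omega> \<in> E \<longleftrightarrow> \<omega>' \<in> E"
  unfolding depends_on_def by metis

lemma depends_on_mono: "depends_on J E \<Longrightarrow> J \<subseteq> K \<Longrightarrow> depends_on K E"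
  unfolding depends_on_def by blast

lemma depends_on_Int: "depends_on J E \<Longrightarrow> depends_on K F \<Longrightarrow> depends_on (J \<union> K) (E \<inter> F)"
  unfolding depends_on_def by (metis IntD1 IntD2 IntI UnI1 UnI2)

lemma depends_on_INT:
  assumes "\<And>i. i \<in> I \<Longrightarrow> depends_on (J i) (E i)"
  shows "depends_on (\<Union>i\<in>I. J i) (\<Inter>i\<in>I. E i)"
  using assms unfolding depends_on_def by (metis INT_iff UN_I)

lemma depends_on_Compl: "depends_on J E \<Longrightarrow> depends_on J (- E)"
  unfolding depends_on_def by (metis Compl_iff)

text \<open>Over a countable alphabet there are only countably many patterns on the finite set
  \<open>J\<close>, so \<open>E\<close> is a countable union of events that prescribe one pattern on
  \<open>J\<close>.\<close>

lemma depends_on_coord_algebra: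
  fixes E :: "(nat \<Rightarrow> 'a :: countable) set"
  assumes fin: "finite J" and J: "\<And>i. i \<in> J \<Longrightarrow> k \<le> i \<and> enat i \<le> n" and E: "depends_on J E"
  shows "E \<in> coord_algebra k n"
proof -
  define N where "N = sigma UNIV {{\<omega> :: nat \<Rightarrow> 'a. \<omega> i \<in> S} | i S. k \<le> i \<and> enat i \<le> n}"
  have sets_N: "sets N = coord_algebra k n" and space_N: "space N = UNIV"
    by (simp_all add: N_def coord_algebra_def)
  have coord: "{\<omega>. \<omega> i \<in> S} \<in> sets N" if "i \<in> J" for i S
    using J[OF that] unfolding sets_N coord_algebra_def by (intro sigma_sets.Basic) blast
  define F where "F = (\<lambda>\<omega>. restrict \<omega> J) ` E"
  have "F \<subseteq> J \<rightarrow>\<^sub>E UNIV"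
    by (auto simp: F_def)
  moreover have "countable (J \<rightarrow>\<^sub>E (UNIV :: 'a set))"
    using fin by (intro countable_PiE) auto
  ultimately have "countable F"
    by (rule countable_subset)
  have "{\<omega> \<in> space N. \<forall>i\<in>J. \<omega> i = f i} \<in> sets N" for f
    using fin coord[of _ "{f _}"] by (intro sets.sets_Collect_finite_All) (auto simp: space_N)
  with \<open>countable F\<close> have "(\<Union>f\<in>F. {\<omega> \<in> space N. \<forall>i\<in>J. \<omega> i = f i}) \<in> sets N"
    by (intro sets.countable_UN'') auto
  moreover have "(\<Union>f\<in>F. {\<omega> \<in> space N. \<forall>i\<in>J. \<omega> i = f i}) = E"
  proof (intro equalityI subsetI)
    fix \<omega> assume "\<omega> \<in> (\<Union>f\<in>F. {\<omega> \<in> space N. \<forall>i\<in>J. \<omega> i = f i})"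
    then obtain \<omega>' where "\<omega>' \<in> E" "\<forall>i\<in>J. \<omega> i = \<omega>' i"
      by (auto simp: F_def)
    then show "\<omega> \<in> E"
      using E unfolding depends_on_def by metis
  qed (auto simp: F_def space_N)
  ultimately show ?thesis
    by (simp add: sets_N)
qed

section \<open>Occurrences of words, periods and first returns\<close>

definition word_at :: "'a list \<Rightarrow> nat \<Rightarrow> (nat \<Rightarrow> 'a) set" where
  "word_at w q = {\<omega>. \<forall>i<length w. \<omega> (q + i) = w ! i}"

lemma funpow_shift: "(shift ^^ k) \<omega> = (\<lambda>i. \<omega> (k + i))"
  by (induction k) (auto simp: shift_def)

lemma vimage_shift_cylinder: "(shift ^^ k) -` cylinder w = word_at w k"
  by (auto simp: funpow_shift cylinder_def word_at_def)

lemma word_at_0: "word_at w 0 = cylinder w"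
  by (simp add: word_at_def cylinder_def)

lemma depends_on_word_at: "depends_on {q..<q + length w} (word_at w q)"
  unfolding depends_on_def word_at_def by auto

text \<open>Every \<open>k \<ge> length w\<close> is a period, vacuously. In particular
  \<open>length w\<close> is one, so for a nonempty word the minimum in \<open>first_return\<close>
  is over a nonempty set.\<close>

definition period :: "'a list \<Rightarrow> nat \<Rightarrow> bool" where
  "period w k \<longleftrightarrow> (\<forall>i. i + k < length w \<longrightarrow> w ! (i + k) = w ! i)"

lemma period_add_mult:
  assumes "period w k" "i + c * k < length w"
  shows "w ! (i + c * k) = w ! i"
  using assms(2)
proof (induction c)
  case (Suc c)
  then have "w ! (i + c * k + k) = w ! (i + c * k)"
    using assms(1)[unfolded period_def, rule_format, of "i + c * k"] by (simp add: add_ac)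
  with Suc show ?case by (simp add: add_ac)
qed simp

lemma period_mod:
  assumes "period w k" "i < length w"
  shows "w ! i = w ! (i mod k)"
  using period_add_mult[OF assms(1), of "i mod k" "i div k"] assms(2) by simp

lemma period_iff_return:
  assumes "k \<le> length w"
  shows "cylinder w \<inter> (shift ^^ k) -` cylinder w \<noteq> {} \<longleftrightarrow> period w k"
proof
  assume "cylinder w \<inter> (shift ^^ k) -` cylinder w \<noteq> {}"
  then obtain \<omega> where \<omega>: "\<omega> \<in> cylinder w" "\<omega> \<in> word_at w k"
    by (auto simp: vimage_shift_cylinder)
  show "period w k"
    unfolding period_def
  proof (intro allI impI)
    fix i assume "i + k < length w"
    moreover have "\<omega> (i + k) = w ! (i + k)"
      using \<omega>(1) calculation unfolding cylinder_def by blast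
    moreover have "\<omega> (k + i) = w ! i"
      using \<omega>(2) calculation(1) unfolding word_at_def by auto
    ultimately show "w ! (i + k) = w ! i"
      by (simp add: add.commute)
  qed
next
  assume per: "period w k"
  \<comment> \<open>A copy of \<open>w\<close> at 0 overlaid with one at \<open>k\<close>; they
    agree on the overlap because \<open>k\<close> is a period. Indices
    \<open>i \<ge> k + length w\<close> lie outside both copies, so the out-of-range value of
    \<open>w ! (i - k)\<close> there is harmless.\<close>
  let ?\<omega> = "\<lambda>i. if i < length w then w ! i else w ! (i - k)"
  have "?\<omega> \<in> word_at w k"
    using per by (auto simp: word_at_def period_def add.commute)
  moreover have "?\<omega> \<in> cylinder w"
    by (simp add: cylinder_def)
  ultimately show "cylinder w \<inter> (shift ^^ k) -` cylinder w \<noteq> {}"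
    unfolding vimage_shift_cylinder by blast
qed

lemma first_return_period:
  assumes "w \<noteq> []"
  defines "r \<equiv> first_return (length w) (cylinder w)"
  shows "period w r" "1 \<le> r" "r \<le> length w"
    and "\<And>k. period w k \<Longrightarrow> 1 \<le> k \<Longrightarrow> r \<le> k"
proof -
  let ?K = "{k \<in> {1..length w}. period w k}"
  have r: "r = Min ?K"
    unfolding r_def first_return_def
    by (rule arg_cong[where f = Min]) (use period_iff_return in fastforce)
  have "length w \<in> ?K"
    using assms(1) by (auto simp: period_def Suc_le_eq)
  then have "r \<in> ?K"
    unfolding r by (intro Min_in) auto
  then show *: "period w r" "1 \<le> r" "r \<le> length w" by auto
  show "r \<le> k" if "period w k" "1 \<le> k" for k
  proof (cases "k \<le> length w")
    case True
    with that show ?thesis unfolding r by (intro Min_le) auto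
  qed (use * in simp)
qed

text \<open>A weak Fine--Wilf theorem: subtracting the least period from another short period leaves a
  period.\<close>

lemma first_return_dvd_period:
  assumes "w \<noteq> []"
  defines "r \<equiv> first_return (length w) (cylinder w)"
  assumes "period w k" "k + r \<le> length w"
  shows "r dvd k"
  using assms(3,4)
proof (induction k rule: less_induct)
  case (less k)
  note r = first_return_period[OF assms(1), folded r_def]
  show ?case
  proof (cases "k = 0")
    case False
    then have "r \<le> k" using r(4) less.prems by simp
    have "period w (k - r)"
      unfolding period_def
    proof (intro allI impI)
      fix i assume i: "i + (k - r) < length w"
      \<comment> \<open>Go down by \<open>r\<close> and up by \<open>k\<close> when
        \<open>r \<le> i\<close>; otherwise go up by \<open>k\<close> first, which stays inside the
        word because \<open>i + k < r + k \<le> length w\<close>.\<close>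
      show "w ! (i + (k - r)) = w ! i"
      proof (cases "r \<le> i")
        case True
        have "w ! (i - r + r) = w ! (i - r)" "w ! (i - r + k) = w ! (i - r)"
          using r(1)[unfolded period_def, rule_format, of "i - r"]
            less.prems(1)[unfolded period_def, rule_format, of "i - r"] less.prems True i \<open>r \<le> k\<close>
          by auto
        with True \<open>r \<le> k\<close> show ?thesis by simp
      next
        case False
        have "w ! (i + k) = w ! i"
          using less.prems False unfolding period_def by auto
        moreover have "w ! (i + (k - r) + r) = w ! (i + (k - r))"
          using r(1)[unfolded period_def, rule_format, of "i + (k - r)"] less.prems False \<open>r \<le> k\<close>
          by simp
        ultimately show ?thesis using \<open>r \<le> k\<close> by simp
      qed
    qed
    then have "r dvd k - r"
      using less.IH[of "k - r"] r(2) \<open>r \<le> k\<close> less.prems by simp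
    with \<open>r \<le> k\<close> show ?thesis by (simp add: dvd_minus_self)
  qed simp
qed

text \<open>Division with remainder by \<open>length w\<close> turns the description by blocks into
  one by single letters, which can be compared with \<open>period_mod\<close>.\<close>

lemma periodic_cylinder_eq:
  assumes "w \<noteq> []"
  shows "periodic_cylinder w m = {\<omega>. \<forall>i<m. \<omega> i = w ! (i mod length w)}"
proof -
  define r where "r = length w"
  have r: "0 < r" using assms by (simp add: r_def)
  have eq: "periodic_cylinder w m =
      {\<omega>. (\<forall>k<m div r. \<forall>i<r. \<omega> (k * r + i) = w ! i) \<and> (\<forall>i<m mod r. \<omega> (r * (m div r) + i) = w ! i)}"
    using r by (auto simp: periodic_cylinder_def Let_def vimage_shift_cylinder word_at_def
      minus_mult_div_eq_mod r_def[symmetric] min_def dest: mod_less_divisor[of r m])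
  have "(\<forall>k<m div r. \<forall>i<r. \<omega> (k * r + i) = w ! i) \<and> (\<forall>i<m mod r. \<omega> (r * (m div r) + i) = w ! i)
      \<longleftrightarrow> (\<forall>i<m. \<omega> i = w ! (i mod r))" (is "?L \<longleftrightarrow> ?R") for \<omega>
  proof
    assume L: ?L
    show ?R
    proof (intro allI impI)
      fix i assume "i < m"
      consider "i div r < m div r" | "i div r = m div r"
        using \<open>i < m\<close> by (metis div_le_mono less_imp_le nat_less_le)
      then show "\<omega> i = w ! (i mod r)"
      proof cases
        case 1
        then have "\<omega> (i div r * r + i mod r) = w ! (i mod r)"
          using L r by (blast intro: mod_less_divisor)
        then show ?thesis by simp
      next
        case 2
        have "i mod r < m mod r"
          using \<open>i < m\<close> 2 by (metis div_mult_mod_eq nat_add_left_cancel_less)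
        then have "\<omega> (r * (m div r) + i mod r) = w ! (i mod r)" using L by simp
        then show ?thesis by (simp add: 2[symmetric])
      qed
    qed
  next
    assume R: ?R
    show ?L
    proof (intro conjI allI impI)
      fix k i assume "k < m div r" "i < r"
      have "k * r + i < Suc k * r" using \<open>i < r\<close> by simp
      also have "\<dots> \<le> m div r * r" using \<open>k < m div r\<close> by (intro mult_le_mono) auto
      also have "\<dots> \<le> m" by simp
      finally show "\<omega> (k * r + i) = w ! i" using R \<open>i < r\<close> by simp
    next
      fix i assume "i < m mod r"
      moreover have "i < r" using \<open>i < m mod r\<close> r by (meson less_trans mod_less_divisor)
      moreover have "r * (m div r) + i < m"
        using \<open>i < m mod r\<close> by (metis mult_div_mod_eq nat_add_left_cancel_less)
      ultimately show "\<omega> (r * (m div r) + i) = w ! i" using R by simp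
    qed
  qed
  then show ?thesis by (simp add: eq r_def)
qed

section \<open>Mixing inequalities\<close>

locale psi_mixing_shift = prob_space M for M :: "(nat \<Rightarrow> 'a :: countable) measure" +
  assumes sets_M: "sets M = sigma_sets UNIV (\<Union>m. cylinders m)"
    and invariant: "\<And>B. B \<in> sets M \<Longrightarrow> measure M (shift -` B) = measure M B"
    and mixing: "psi_mixing M"
begin

lemma space_M [simp]: "space M = UNIV"
proof -
  have "UNIV \<in> sets M"
    unfolding sets_M by (rule sigma_sets_top)
  then show ?thesis
    using sets.sets_into_space by auto
qed

lemma coord_algebra_subset: "coord_algebra k m \<subseteq> sets M"
  unfolding coord_algebra_def
proof (rule sets.sigma_sets_subset[of _ M, simplified], clarify)
  fix i and S :: "'a set"
  have "cylinder w \<in> sets M" for w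
    unfolding sets_M cylinders_def by (intro sigma_sets.Basic) blast
  then have "(\<Union>w\<in>{w. length w = Suc i \<and> w ! i \<in> S}. cylinder w) \<in> sets M"
    by (intro sets.countable_UN'') auto
  also have "(\<Union>w\<in>{w. length w = Suc i \<and> w ! i \<in> S}. cylinder w) = {\<omega>. \<omega> i \<in> S}"
  proof (intro equalityI subsetI)
    fix \<omega> assume "\<omega> \<in> {\<omega>. \<omega> i \<in> S}"
    then show "\<omega> \<in> (\<Union>w\<in>{w. length w = Suc i \<and> w ! i \<in> S}. cylinder w)"
      by (intro UN_I[of "map \<omega> [0..<Suc i]"]) (auto simp: cylinder_def nth_append simp del: upt_Suc)
  qed (auto simp: cylinder_def)
  finally show "{\<omega>. \<omega> i \<in> S} \<in> sets M" .
qed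

lemma depends_on_sets: "finite J \<Longrightarrow> depends_on J E \<Longrightarrow> E \<in> sets M"
  using depends_on_coord_algebra[of J 0 \<infinity> E] coord_algebra_subset by auto

lemma sets_word_at [measurable, simp]: "word_at w q \<in> sets M"
  by (rule depends_on_sets[OF _ depends_on_word_at]) simp

lemma prob_shift_word_at: "prob (word_at w q) = prob (cylinder w)"
proof (induction q)
  case (Suc q)
  have "word_at w (Suc q) = shift -` word_at w q"
    by (auto simp: word_at_def shift_def)
  then show ?case
    using invariant[OF sets_word_at] Suc by simp
qed (simp add: word_at_0)

lemma prob_shift_word_at_Int:
  "prob (word_at w (q + i) \<inter> word_at v (q + j)) = prob (word_at w i \<inter> word_at v j)"
proof (induction q)
  case (Suc q)
  have "word_at w (Suc q + i) \<inter> word_at v (Suc q + j)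
      = shift -` (word_at w (q + i) \<inter> word_at v (q + j))"
    by (auto simp: word_at_def shift_def)
  then show ?case
    using invariant[of "word_at w (q + i) \<inter> word_at v (q + j)"] Suc by simp
qed simp

text \<open>A larger gap leaves a smaller algebra for the future, so every coefficient is at most
  the one for gap 0. Hence the conversion by \<open>enn2real\<close> never meets
  \<infinity>.\<close>

lemma psi_coeff_finite: "psi_coeff M g < \<infinity>"
proof -
  have sub: "coord_algebra (q + g + 1) \<infinity> \<subseteq> coord_algebra (q + 0 + 1) \<infinity>" for q
    unfolding coord_algebra_def by (intro sigma_sets_mono') force
  have "psi_coeff M g \<le> psi_coeff M 0"
    unfolding psi_coeff_def psi_dep_def
    by (intro SUP_mono bexI[of _ "_ :: nat"] SUP_subset_mono) (use sub in auto)
  then show ?thesis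
    using mixing unfolding psi_mixing_def by (auto intro: le_less_trans)
qed

lemma psi_nonneg: "0 \<le> psi M g"
  by (simp add: psi_def)

text \<open>The product form of the definition of \<psi>, free of division and hence also valid for
  null events.\<close>

lemma mixing_bound:
  assumes fin: "finite J" "finite K"
    and dep: "depends_on J B" "depends_on K C"
    and gap: "\<And>i j. i \<in> J \<Longrightarrow> j \<in> K \<Longrightarrow> i + g < j"
  shows "\<bar>prob (B \<inter> C) - prob B * prob C\<bar> \<le> psi M g * (prob B * prob C)"
proof (cases "J = {} \<or> prob B * prob C = 0")
  \<comment> \<open>An empty \<open>J\<close> has no last index, and the supremum omits null events;
    in both cases the joint probability equals the product exactly.\<close>
  case True
  have sets: "B \<in> sets M" "C \<in> sets M"
    using fin dep depends_on_sets by auto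
  have "prob (B \<inter> C) = prob B * prob C"
  proof (cases "J = {}")
    case True
    then have "B = {} \<or> B = UNIV"
      using dep(1) unfolding depends_on_def by blast
    then show ?thesis
      using prob_space by auto
  next
    case False
    with True have "prob B = 0 \<or> prob C = 0" by simp
    moreover have "prob (B \<inter> C) \<le> prob B" "prob (B \<inter> C) \<le> prob C"
      using sets by (auto intro!: finite_measure_mono)
    ultimately show ?thesis
      using measure_nonneg[of M "B \<inter> C"] by (auto simp: measure_le_0_iff)
  qed
  then show ?thesis
    using psi_nonneg by simp
next
  case False
  define q where "q = Max J"
  have q: "q \<in> J" "\<And>i. i \<in> J \<Longrightarrow> i \<le> q"
    using fin False by (auto simp: q_def)
  have "B \<in> coord_algebra 0 (enat q)"
    using fin dep q by (intro depends_on_coord_algebra) auto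
  moreover have "C \<in> coord_algebra (q + g + 1) \<infinity>"
    using fin dep gap[OF q(1)] by (intro depends_on_coord_algebra) (auto simp: Suc_le_eq)
  ultimately have "ennreal \<bar>prob (B \<inter> C) / (prob B * prob C) - 1\<bar>
      \<le> psi_dep M (coord_algebra 0 (enat q)) (coord_algebra (q + g + 1) \<infinity>)"
    unfolding psi_dep_def using False by (intro SUP_upper2[of "(B, C)"]) auto
  also have "\<dots> \<le> psi_coeff M g"
    unfolding psi_coeff_def by (rule SUP_upper) simp
  also have "\<dots> = ennreal (psi M g)"
    using psi_coeff_finite[of g] by (simp add: psi_def)
  finally have *: "\<bar>prob (B \<inter> C) / (prob B * prob C) - 1\<bar> \<le> psi M g"
    using psi_nonneg by simp
  have pos: "0 < prob B * prob C"
    using False by (simp add: zero_less_measure_iff)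
  have "prob (B \<inter> C) - prob B * prob C = (prob (B \<inter> C) / (prob B * prob C) - 1) * (prob B * prob C)"
    using False by (simp add: field_simps)
  then have "\<bar>prob (B \<inter> C) - prob B * prob C\<bar>
      = \<bar>prob (B \<inter> C) / (prob B * prob C) - 1\<bar> * (prob B * prob C)"
    by (simp add: abs_mult abs_of_nonneg)
  also have "\<dots> \<le> psi M g * (prob B * prob C)"
    using * pos by (intro mult_right_mono) auto
  finally show ?thesis .
qed

lemma mixing_upper:
  assumes "finite J" "finite K" "depends_on J B" "depends_on K C"
    and "\<And>i j. i \<in> J \<Longrightarrow> j \<in> K \<Longrightarrow> i + g < j"
  shows "prob (B \<inter> C) \<le> (1 + psi M g) * (prob B * prob C)"
  using mixing_bound[OF assms] by (simp add: algebra_simps)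

definition mix_hi :: "nat \<Rightarrow> real" where
  "mix_hi g = (1 + psi M g)\<^sup>2 / (1 - psi M g)"

definition mix_lo :: "nat \<Rightarrow> real" where
  "mix_lo g = (1 - psi M g)\<^sup>2 / (1 + psi M g)"

text \<open>For a fixed past, \<open>E\<close> is an intersection of a past event and a future event; the coefficients
  compare \<open>\<P>(G \<inter> C \<inter> H)\<close> first with \<open>\<P>(G) \<P>(C) \<P>(H)\<close> and then with \<open>\<P>(C) \<P>(G \<inter> H)\<close>.\<close>

lemma mixing_middle:
  assumes small: "psi M g < 1" and "u < v"
    and C: "depends_on {u..<v} C"
    and E: "finite K" "depends_on K E"
    and gap: "\<And>j. j \<in> K \<Longrightarrow> j + g < u \<or> v + g \<le> j"
  shows "prob (E \<inter> C) \<le> mix_hi g * (prob E * prob C)"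
    and "mix_lo g * (prob E * prob C) \<le> prob (E \<inter> C)"
proof -
  \<comment> \<open>Coordinates below \<open>b\<close> are those left of the window by more than the
    gap; for \<open>g \<ge> u\<close> truncation gives \<open>b = 0\<close> and there is no past.
    The events \<open>G k\<close> partition the space by the first \<open>b\<close> letters.\<close>
  define b where "b = u - g"
  define G where "G k = {\<omega> :: nat \<Rightarrow> 'a. to_nat (map \<omega> [0..<b]) = k}" for k
  have G: "depends_on {..<b} (G k)" for k
    unfolding depends_on_def G_def by (auto cong: map_cong)
  have sets: "G k \<in> sets M" "E \<in> sets M" "C \<in> sets M" for k
    using depends_on_sets[OF _ G] depends_on_sets[OF E] depends_on_sets[OF _ C] by auto
  let ?\<psi> = "psi M g"
  have local: "prob (E \<inter> C \<inter> G k) \<le> mix_hi g * prob C * prob (E \<inter> G k) \<and>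
      mix_lo g * prob C * prob (E \<inter> G k) \<le> prob (E \<inter> C \<inter> G k)" for k
  proof (cases "G k = {}")
    case False
    then obtain \<omega>0 where \<omega>0: "\<omega>0 \<in> G k" by blast
    \<comment> \<open>Freezing the first \<open>b\<close> letters at those of
      \<open>\<omega>0\<close> removes the past from \<open>E\<close>: inside \<open>G k\<close>
      nothing changes, and \<open>H\<close> only sees coordinates beyond the window.\<close>
    define H where "H = {\<omega>. (\<lambda>i. if i < b then \<omega>0 i else \<omega> i) \<in> E}"
    have H: "depends_on (K \<inter> {b..}) H"
      unfolding depends_on_def H_def
    proof (intro allI impI, unfold mem_Collect_eq)
      fix \<omega> \<omega>' assume *: "\<forall>i\<in>K \<inter> {b..}. \<omega> i = \<omega>' i"
        and "(\<lambda>i. if i < b then \<omega>0 i else \<omega> i) \<in> E"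
      then show "(\<lambda>i. if i < b then \<omega>0 i else \<omega>' i) \<in> E"
        by (subst depends_onD[OF E(2), of _ "\<lambda>i. if i < b then \<omega>0 i else \<omega> i"]) auto
    qed
    have EG: "E \<inter> G k = G k \<inter> H"
    proof -
      have "(\<lambda>i. if i < b then \<omega>0 i else \<omega> i) = \<omega>" if "\<omega> \<in> G k" for \<omega>
        using that \<omega>0 by (auto simp: G_def)
      then show ?thesis by (auto simp: H_def)
    qed
    have fin: "finite (K \<inter> {b..})" using E by simp
    have fut: "v + g \<le> j" if "j \<in> K \<inter> {b..}" for j
      using gap[of j] that by (auto simp: b_def)
    have GC: "depends_on ({..<b} \<union> {u..<v}) (G k \<inter> C)"
      by (rule depends_on_Int[OF G C])
    have g1: "i + g < j" if "i \<in> {..<b}" "j \<in> {u..<v}" for i j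
      using that by (auto simp: b_def)
    have g2: "i + g < j" if "i \<in> {..<b} \<union> {u..<v}" "j \<in> K \<inter> {b..}" for i j
      using that fut[OF that(2)] \<open>u < v\<close> by (auto simp: b_def)
    have g3: "i + g < j" if "i \<in> {..<b}" "j \<in> K \<inter> {b..}" for i j
      using that fut[OF that(2)] \<open>u < v\<close> by (auto simp: b_def)
    have eq: "E \<inter> C \<inter> G k = (G k \<inter> C) \<inter> H"
      using EG by auto
    note mix =
      mixing_bound[OF _ fin GC H g2, simplified]
      mixing_bound[OF _ _ G[of k] C g1, simplified]
      mixing_bound[OF _ fin G[of k] H g3, simplified]
    let ?x = "prob (G k)" and ?y = "prob C" and ?z = "prob H"
    \<comment> \<open>Here mixing of past and future is used backwards, which is where the divisors
      in \<open>mix_hi\<close> and \<open>mix_lo\<close> come from.\<close>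
    have xz: "?x * ?z \<le> prob (E \<inter> G k) / (1 - ?\<psi>)" "prob (E \<inter> G k) / (1 + ?\<psi>) \<le> ?x * ?z"
      using mix(3) small psi_nonneg[of g] by (simp_all add: EG field_simps)
    have "prob (E \<inter> C \<inter> G k) \<le> (1 + ?\<psi>) * (prob (G k \<inter> C) * ?z)"
      using mix(1) by (simp add: eq algebra_simps)
    also have "\<dots> \<le> (1 + ?\<psi>) * ((1 + ?\<psi>) * (?x * ?y) * ?z)"
      using mix(2) psi_nonneg[of g]
      by (intro mult_left_mono mult_right_mono) (auto simp: algebra_simps)
    also have "\<dots> = (1 + ?\<psi>)\<^sup>2 * ?y * (?x * ?z)"
      by (simp add: power2_eq_square)
    also have "\<dots> \<le> (1 + ?\<psi>)\<^sup>2 * ?y * (prob (E \<inter> G k) / (1 - ?\<psi>))"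
      using xz by (intro mult_left_mono) auto
    finally have upper: "prob (E \<inter> C \<inter> G k) \<le> mix_hi g * ?y * prob (E \<inter> G k)"
      by (simp add: mix_hi_def)
    have "mix_lo g * ?y * prob (E \<inter> G k) = (1 - ?\<psi>)\<^sup>2 * ?y * (prob (E \<inter> G k) / (1 + ?\<psi>))"
      by (simp add: mix_lo_def)
    also have "\<dots> \<le> (1 - ?\<psi>)\<^sup>2 * ?y * (?x * ?z)"
      using xz by (intro mult_left_mono) auto
    also have "\<dots> = (1 - ?\<psi>) * ((1 - ?\<psi>) * (?x * ?y) * ?z)"
      by (simp add: power2_eq_square)
    also have "\<dots> \<le> (1 - ?\<psi>) * (prob (G k \<inter> C) * ?z)"
      using mix(2) small by (intro mult_left_mono mult_right_mono) (auto simp: algebra_simps)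
    also have "\<dots> \<le> prob (E \<inter> C \<inter> G k)"
      using mix(1) by (simp add: eq algebra_simps)
    finally show ?thesis using upper by blast
  qed (simp add: psi_nonneg)
  show "prob (E \<inter> C) \<le> mix_hi g * (prob E * prob C)"
    and "mix_lo g * (prob E * prob C) \<le> prob (E \<inter> C)"
  proof -
    \<comment> \<open>The bounds on the \<open>G k\<close> are linear in
      \<open>prob (E \<inter> G k)\<close> with factors independent of \<open>k\<close>, so they may
      be summed over the partition.\<close>
    have sums: "(\<lambda>k. prob (F \<inter> G k)) sums prob F" if "F \<in> sets M" for F
    proof -
      have "(\<lambda>k. prob (F \<inter> G k)) sums prob (\<Union>k. F \<inter> G k)"
        using that sets by (intro finite_measure_UNION) (auto simp: disjoint_family_on_def G_def)
      also have "(\<Union>k. F \<inter> G k) = F"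
        by (auto simp: G_def)
      finally show ?thesis .
    qed
    have EC: "E \<inter> C \<in> sets M" using sets by simp
    show "prob (E \<inter> C) \<le> mix_hi g * (prob E * prob C)"
      using sums_le[OF _ sums[OF EC] sums_mult[OF sums[OF sets(2)], of "mix_hi g * prob C"]] local
      by (simp add: mult_ac)
    show "mix_lo g * (prob E * prob C) \<le> prob (E \<inter> C)"
      using sums_le[OF _ sums_mult[OF sums[OF sets(2)], of "mix_lo g * prob C"] sums[OF EC]] local
      by (simp add: mult_ac)
  qed
qed

text \<open>Blocks are split off one at a time: the other blocks are absorbed into the surrounding
  event, and each block costs one factor. Windows are half-open, hence the strict inequality before
  a window and the weak one after it.\<close>

lemma mixing_blocks:
  assumes small: "psi M g < 1"
    and blocks: "finite I" "\<And>i. i \<in> I \<Longrightarrow> u i < v i" "\<And>i. i \<in> I \<Longrightarrow> depends_on {u i..<v i} (C i)"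
    and sep: "\<And>i j. i \<in> I \<Longrightarrow> j \<in> I \<Longrightarrow> i \<noteq> j \<Longrightarrow> v i + g \<le> u j \<or> v j + g \<le> u i"
    and E: "finite K" "depends_on K E"
    and gap: "\<And>i j. i \<in> I \<Longrightarrow> j \<in> K \<Longrightarrow> j + g < u i \<or> v i + g \<le> j"
  shows "prob (E \<inter> (\<Inter>i\<in>I. C i)) \<le> mix_hi g ^ card I * (prob E * (\<Prod>i\<in>I. prob (C i)))"
    and "mix_lo g ^ card I * (prob E * (\<Prod>i\<in>I. prob (C i))) \<le> prob (E \<inter> (\<Inter>i\<in>I. C i))"
proof -
  have "prob (E \<inter> (\<Inter>i\<in>I. C i)) \<le> mix_hi g ^ card I * (prob E * (\<Prod>i\<in>I. prob (C i))) \<and>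
    mix_lo g ^ card I * (prob E * (\<Prod>i\<in>I. prob (C i))) \<le> prob (E \<inter> (\<Inter>i\<in>I. C i))"
    using blocks sep gap
  proof (induction I rule: finite_induct)
    case (insert i I)
    let ?F = "E \<inter> (\<Inter>i\<in>I. C i)" and ?P = "\<Prod>i\<in>I. prob (C i)"
    let ?K = "K \<union> (\<Union>i\<in>I. {u i..<v i})"
    have IH: "prob ?F \<le> mix_hi g ^ card I * (prob E * ?P)" "mix_lo g ^ card I * (prob E * ?P) \<le> prob ?F"
      using insert by auto
    have F: "depends_on ?K ?F"
      using insert.prems by (intro depends_on_Int E depends_on_INT) auto
    have away: "j + g < u i \<or> v i + g \<le> j" if j: "j \<in> ?K" for j
    proof (cases "j \<in> K")
      case False
      then obtain i' where i': "i' \<in> I" "u i' \<le> j" "j < v i'" using j False by auto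
      then have "i' \<noteq> i" using insert.hyps by auto
      with i' insert.prems(3)[of i' i] show ?thesis by auto
    qed (use insert.prems(4) in simp)
    note mid = mixing_middle[OF small _ _ _ F, of "u i" "v i" "C i"]
    have eq: "E \<inter> (\<Inter>i\<in>insert i I. C i) = ?F \<inter> C i" by auto
    have hi: "0 \<le> mix_hi g" and lo: "0 \<le> mix_lo g"
      using small psi_nonneg[of g] by (auto simp: mix_hi_def mix_lo_def)
    have "prob (?F \<inter> C i) \<le> mix_hi g * (prob ?F * prob (C i))"
      using away insert E by (intro mid) auto
    also have "\<dots> \<le> mix_hi g * (mix_hi g ^ card I * (prob E * ?P) * prob (C i))"
      using IH hi by (intro mult_left_mono mult_right_mono) auto
    finally have 1: "prob (?F \<inter> C i) \<le> mix_hi g * (mix_hi g ^ card I * (prob E * ?P) * prob (C i))" .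
    have "mix_lo g * (mix_lo g ^ card I * (prob E * ?P) * prob (C i)) \<le> mix_lo g * (prob ?F * prob (C i))"
      using IH lo by (intro mult_left_mono mult_right_mono) auto
    also have "\<dots> \<le> prob (?F \<inter> C i)"
      using away insert E by (intro mid) auto
    finally have 2: "mix_lo g * (mix_lo g ^ card I * (prob E * ?P) * prob (C i)) \<le> prob (?F \<inter> C i)" .
    show ?case
      using 1 2 insert.hyps unfolding eq by (simp add: mult_ac)
  qed simp
  then show "prob (E \<inter> (\<Inter>i\<in>I. C i)) \<le> mix_hi g ^ card I * (prob E * (\<Prod>i\<in>I. prob (C i)))"
    and "mix_lo g ^ card I * (prob E * (\<Prod>i\<in>I. prob (C i))) \<le> prob (E \<inter> (\<Inter>i\<in>I. C i))"
    by auto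
qed

text \<open>The smallness condition keeps the \<open>l\<close>-th power of \<open>mix_hi\<close>
  bounded, so the \<open>l\<close>-th powers of both coefficients differ from 1 by at most a
  multiple of \<open>l * psi M g\<close>. The factor \<open>prob E \<le> 1\<close> is dropped from
  the error.\<close>

lemma mixing_blocks_error:
  assumes l: "card I = l" "finite I" and small: "(1 + psi M g) ^ (l + 1) < 3 / 2"
    and blocks: "\<And>i. i \<in> I \<Longrightarrow> u i < v i" "\<And>i. i \<in> I \<Longrightarrow> depends_on {u i..<v i} (C i)"
    and sep: "\<And>i j. i \<in> I \<Longrightarrow> j \<in> I \<Longrightarrow> i \<noteq> j \<Longrightarrow> v i + g \<le> u j \<or> v j + g \<le> u i"
    and E: "finite K" "depends_on K E"
    and gap: "\<And>i j. i \<in> I \<Longrightarrow> j \<in> K \<Longrightarrow> j + g < u i \<or> v i + g \<le> j"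
  shows "\<bar>prob (E \<inter> (\<Inter>i\<in>I. C i)) - prob E * (\<Prod>i\<in>I. prob (C i))\<bar>
    \<le> 36 * real l * psi M g * (\<Prod>i\<in>I. prob (C i))"
proof (cases "l = 0")
  case True
  with l have "I = {}" by simp
  then show ?thesis using True by simp
next
  case False
  define y where "y = psi M g"
  have y0: "0 \<le> y" by (simp add: y_def psi_nonneg)
  \<comment> \<open>Bernoulli turns the hypothesis into \<open>(l + 1) * y < 1 / 2\<close>, and
    \<open>l \<ge> 1\<close> then gives \<open>y < 1 / 4\<close>.\<close>
  have "1 + real (l + 1) * y \<le> (1 + y) ^ (l + 1)"
    using y0 by (intro Bernoulli_inequality) simp
  with small have ly: "real (l + 1) * y < 1 / 2" by (simp add: y_def)
  moreover have "2 * y \<le> real (l + 1) * y"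
    using False y0 by (intro mult_right_mono) auto
  ultimately have y4: "y < 1 / 4" by simp
  define h where "h = mix_hi g"
  have h: "h = (1 + y)\<^sup>2 / (1 - y)" by (simp add: h_def mix_hi_def y_def)
  have h1: "h - 1 \<le> 5 * y" "1 \<le> h"
  proof -
    have "y * y \<le> y * (1 / 4)" using y0 y4 by (intro mult_left_mono) auto
    then show "h - 1 \<le> 5 * y" "1 \<le> h" using y4 y0
      unfolding h by (simp_all add: field_simps power2_eq_square)
  qed
  have "1 - real l * y \<le> (1 - y) ^ l"
    using Bernoulli_inequality[of "- y" l] y4 by simp
  moreover have "real l * y \<le> 1 / 2" using ly y0 by (simp add: algebra_simps)
  ultimately have "1 / 2 \<le> (1 - y) ^ l" by simp
  moreover have "(1 + y) ^ l \<le> (1 + y) ^ (l + 1)"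
    using y0 by (intro power_increasing) auto
  then have "(1 + y) ^ l \<le> 3 / 2"
    using small by (simp add: y_def)
  then have "((1 + y) ^ l)\<^sup>2 \<le> (3 / 2)\<^sup>2"
    using y0 by (intro power_mono) auto
  ultimately have "((1 + y) ^ l)\<^sup>2 / (1 - y) ^ l \<le> (9 / 4) / (1 / 2)"
    by (intro frac_le) (auto simp: power2_eq_square)
  then have hl: "h ^ l \<le> 9 / 2"
    by (simp add: h power_divide power_mult[symmetric] mult.commute)
  \<comment> \<open>A geometric sum with all terms at most 9/2 gives \<open>45 / 2 * l * y\<close>,
    rounded up to 36.\<close>
  have "h ^ l - 1 = (h - 1) * (\<Sum>i<l. h ^ i)"
    by (simp add: power_diff_1_eq)
  also have "\<dots> \<le> 5 * y * (\<Sum>i<l. 9 / 2)"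
    using h1 y0 by (intro mult_mono sum_mono order_trans[OF power_increasing hl]) (auto intro: sum_nonneg)
  finally have hi: "h ^ l - 1 \<le> 36 * real l * y"
    using y0 by (auto intro: order_trans[of _ "5 * y * (real l * (9 / 2))"])
  define k where "k = mix_lo g"
  have k: "k = (1 - y)\<^sup>2 / (1 + y)" by (simp add: k_def mix_lo_def y_def)
  have k1: "1 - k \<le> 3 * y"
    using y0 y4 unfolding k by (simp add: field_simps power2_eq_square)
  have "0 \<le> k"
    using y0 by (simp add: k)
  have "1 + real l * (k - 1) \<le> k ^ l"
    using Bernoulli_inequality[of "k - 1" l] \<open>0 \<le> k\<close> by simp
  moreover have "real l * (1 - k) \<le> real l * (3 * y)"
    using k1 by (intro mult_left_mono) auto
  moreover have "real l * (3 * y) \<le> 36 * real l * y"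
    using mult_nonneg_nonneg[OF of_nat_0_le_iff[of l] y0] by (simp add: mult_ac)
  ultimately have lo: "1 - k ^ l \<le> 36 * real l * y"
    by (simp add: algebra_simps)
  define P where "P = (\<Prod>i\<in>I. prob (C i))"
  have P: "0 \<le> P" by (simp add: P_def prod_nonneg)
  have e: "0 \<le> prob E * P" "prob E * P \<le> P"
    using P by (auto simp: mult_left_le_one_le)
  have psi1: "psi M g < 1" using y4 by (simp add: y_def)
  note mb = mixing_blocks[where g = g and I = I and u = u and v = v and C = C,
    OF psi1 l(2) blocks sep E gap, folded P_def h_def k_def, unfolded l(1)]
  have "36 * real l * y * (prob E * P) \<le> 36 * real l * y * P"
    using e y0 by (intro mult_left_mono) auto
  moreover have "(h ^ l - 1) * (prob E * P) \<le> 36 * real l * y * (prob E * P)"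
    "(1 - k ^ l) * (prob E * P) \<le> 36 * real l * y * (prob E * P)"
    using hi lo e by (intro mult_right_mono; simp)+
  ultimately show ?thesis
    using mb unfolding P_def[symmetric] y_def[symmetric] by (simp add: algebra_simps abs_le_iff)
qed

end

section \<open>Hits, clumps and the times near them\<close>

locale multiple_recurrence = psi_mixing_shift M for M :: "(nat \<Rightarrow> 'a :: countable) measure" +
  fixes l :: nat and d :: "nat \<Rightarrow> nat" and a :: "'a list" and \<Gamma> :: real
  assumes l: "1 \<le> l"
    and d1: "1 \<le> d 1" and d: "strict_mono_on {1..l} d"
    and a: "a \<noteq> []" and pos: "0 < prob (cylinder a)"
    and Gamma_pos: "0 < \<Gamma>"
    and prob_le_exp: "\<And>w. w \<noteq> [] \<Longrightarrow> prob (cylinder w) \<le> exp (- \<Gamma> * real (length w))"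
    and psi_small: "(1 + psi M (length a)) ^ (l + 1) < 3 / 2"
begin

definition n :: nat where "n = length a"
definition p :: real where "p = prob (cylinder a)"
definition r :: nat where "r = first_return n (cylinder a)"
definition \<kappa> :: nat where "\<kappa> = kappa l d r"

definition hit :: "nat \<Rightarrow> (nat \<Rightarrow> 'a) set" where
  "hit j = (\<Inter>i\<in>{1..l}. word_at a (d i * j))"

text \<open>The subtraction is truncated; the estimates use \<open>m > 4 * d l * n\<close>, where
  \<open>m - \<kappa>\<close> is positive.\<close>

definition clump_start :: "nat \<Rightarrow> (nat \<Rightarrow> 'a) set" where
  "clump_start m = hit m - hit (m - \<kappa>)"

definition no_hit :: "nat \<Rightarrow> (nat \<Rightarrow> 'a) set" where
  "no_hit m = {\<omega>. \<forall>j\<in>{1..m}. \<omega> \<notin> hit j}"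

text \<open>By stationarity, also the probability of \<open>a\<close> at both
  \<open>d i * (m - \<kappa>)\<close> and \<open>d i * m\<close> when
  \<open>\<kappa> \<le> m\<close>.\<close>

definition c :: "nat \<Rightarrow> real" where
  "c i = prob (word_at a 0 \<inter> word_at a (d i * \<kappa>))"

text \<open>For each \<open>i\<close> the windows at times \<open>m - \<kappa>\<close> and
  \<open>m\<close> lie in \<open>{d i * (m - \<kappa>)..<d i * m + n}\<close>. In
  \<open>2 * n\<close> one \<open>n\<close> is the length of a window and the other the gap required
  for mixing.\<close>

definition near :: "nat \<Rightarrow> nat set" where
  "near m = {j \<in> {1..<m}. \<exists>i\<in>{1..l}. \<exists>i'\<in>{1..l}.
    d i * (m - \<kappa>) < d i' * j + 2 * n \<and> d i' * j < d i * m + 2 * n}"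

lemma n_pos: "1 \<le> n" using a by (simp add: n_def Suc_le_eq)

lemma d_less: "1 \<le> i \<Longrightarrow> i < j \<Longrightarrow> j \<le> l \<Longrightarrow> d i < d j"
  using d unfolding strict_mono_on_def by auto

lemma d_bounds:
  assumes "i \<in> {1..l}"
  shows "1 \<le> d i" "d i \<le> d l"
proof -
  show "1 \<le> d i" using d_less[of 1 i] d1 assms by (cases "i = 1") auto
  show "d i \<le> d l" using d_less[of i l] assms by (cases "i = l") auto
qed

lemma r: "period a r" "1 \<le> r" "r \<le> n" "\<And>k. period a k \<Longrightarrow> 1 \<le> k \<Longrightarrow> r \<le> k"
  using first_return_period[OF a] by (auto simp: r_def n_def)

lemma r_dvd_d_kappa: "i \<in> {1..l} \<Longrightarrow> r dvd d i * \<kappa>"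
proof -
  assume i: "i \<in> {1..l}"
  have "r div gcd r (d i) dvd \<kappa>"
    using i unfolding \<kappa>_def kappa_def by (intro dvd_Lcm) auto
  then have "gcd r (d i) * (r div gcd r (d i)) dvd d i * \<kappa>"
    by (intro mult_dvd_mono) auto
  then show ?thesis by simp
qed

text \<open>Cancelling the gcd from \<open>r dvd d i * s\<close> leaves
  \<open>r div gcd r (d i) dvd s\<close>. Together with \<open>r_dvd_d_kappa\<close> this makes
  \<open>\<kappa>\<close> the least positive shift that moves every window by a multiple of
  \<open>r\<close>.\<close>

lemma kappa_dvd:
  assumes "\<And>i. i \<in> {1..l} \<Longrightarrow> r dvd d i * s"
  shows "\<kappa> dvd s"
  unfolding \<kappa>_def kappa_def
proof (rule Lcm_least, clarify)
  fix i assume i: "i \<in> {1..l}"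
  define g where "g = gcd r (d i)"
  have g: "g \<noteq> 0" using r(2) by (simp add: g_def)
  have cop: "coprime (r div g) (d i div g)"
    unfolding g_def using r(2) by (intro div_gcd_coprime) auto
  have "g * (r div g) dvd g * (d i div g * s)"
    using assms[OF i] by (simp add: g_def mult.assoc[symmetric])
  then have "r div g dvd d i div g * s"
    using g by simp
  then show "r div gcd r (d i) dvd s"
    using cop by (simp add: coprime_dvd_mult_right_iff g_def)
qed

lemma kappa_bounds: "1 \<le> \<kappa>" "\<kappa> \<le> n"
proof -
  \<comment> \<open>The shift \<open>s = r\<close> satisfies all the divisibility
    conditions.\<close>
  have "\<kappa> dvd r" by (rule kappa_dvd) simp
  then show "1 \<le> \<kappa>" "\<kappa> \<le> n"
    using r(2,3) by (auto dest: dvd_imp_le intro: Suc_leI Nat.gr0I)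
qed

lemma p_bounds: "0 < p" "p \<le> exp (- \<Gamma> * real n)" "p \<le> 1"
  using pos prob_le_exp[OF a] by (auto simp: p_def n_def)

lemma prob_word_at: "prob (word_at a q) = p"
  by (simp add: prob_shift_word_at p_def)

lemma depends_on_hit: "depends_on (\<Union>i\<in>{1..l}. {d i * j..<d i * j + n}) (hit j)"
  unfolding hit_def n_def by (intro depends_on_INT depends_on_word_at)

lemma sets_hit [measurable, simp]: "hit j \<in> sets M"
  by (rule depends_on_sets[OF _ depends_on_hit]) simp

lemma sets_clump_start [measurable, simp]: "clump_start j \<in> sets M"
  by (simp add: clump_start_def)

lemma no_hit_eq: "no_hit m = (\<Inter>j\<in>{1..m}. - hit j)"
  by (auto simp: no_hit_def)

lemma depends_on_avoid:
  "depends_on (\<Union>j\<in>J. \<Union>i\<in>{1..l}. {d i * j..<d i * j + n}) (\<Inter>j\<in>J. - hit j)"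
  by (intro depends_on_INT depends_on_Compl depends_on_hit)

lemma sets_avoid [simp]: "finite J \<Longrightarrow> (\<Inter>j\<in>J. - hit j) \<in> sets M"
  by (rule depends_on_sets[OF _ depends_on_avoid]) auto

lemma sets_no_hit [measurable, simp]: "no_hit m \<in> sets M"
  by (simp add: no_hit_eq)

lemma hit_subset: "i \<in> {1..l} \<Longrightarrow> hit j \<subseteq> word_at a (d i * j)"
  by (auto simp: hit_def)

lemma prob_hit_le: "prob (hit j) \<le> p"
  using finite_measure_mono[OF hit_subset[of 1 j]] l by (simp add: prob_word_at)

text \<open>Two hits at a short distance overlap in periodic stretches, so the distance is a
  multiple of \<open>\<kappa>\<close> and the stretches contain another hit \<open>\<kappa>\<close> steps before the later one.\<close>

lemma hit_close:
  assumes hits: "\<omega> \<in> hit j" "\<omega> \<in> hit (j + s)" and s: "1 \<le> s" "2 * (d l * s) < n"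
  shows "\<omega> \<in> hit (j + s - \<kappa>)"
proof -
  have at: "\<omega> (d i * j + q) = a ! q" "\<omega> (d i * (j + s) + q) = a ! q" if "i \<in> {1..l}" "q < n" for i q
    using hits that by (auto simp: hit_def word_at_def n_def)
  have per: "period a (d i * s)" and short: "2 * (d i * s) < n" if i: "i \<in> {1..l}" for i
  proof -
    show "period a (d i * s)"
      unfolding period_def
    proof (intro allI impI)
      fix q assume "q + d i * s < length a"
      then show "a ! (q + d i * s) = a ! q"
        using at(1)[OF i, of "q + d i * s"] at(2)[OF i, of q] by (simp add: n_def algebra_simps)
    qed
    have "d i * s \<le> d l * s" using d_bounds(2)[OF i] by simp
    then show "2 * (d i * s) < n" using s by linarith
  qed
  have dvd: "r dvd d i * s" if i: "i \<in> {1..l}" for i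
  proof -
    \<comment> \<open>The least period and \<open>d i * s\<close> add up to at most
      \<open>2 * (d i * s) < n\<close>, as the Fine--Wilf lemma requires.\<close>
    have "r \<le> d i * s" using r(4)[OF per[OF i]] d_bounds[OF i] s by simp
    then show ?thesis
      using first_return_dvd_period[OF a per[OF i]] short[OF i] by (simp add: r_def n_def)
  qed
  then have "\<kappa> dvd s" by (rule kappa_dvd)
  then have ks: "\<kappa> \<le> s" using s by (simp add: dvd_imp_le)
  show "\<omega> \<in> hit (j + s - \<kappa>)"
    unfolding hit_def
  proof (intro INT_I)
    fix i assume i: "i \<in> {1..l}"
    have amod: "a ! q = a ! (q mod r)" if "q < n" for q
      using period_mod[OF r(1)] that by (simp add: n_def)
    have base: "d i * (j + s - \<kappa>) = d i * j + d i * (s - \<kappa>)"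
      using ks by (simp add: add_mult_distrib2[symmetric])
    have base': "d i * (j + s) = d i * (j + s - \<kappa>) + d i * \<kappa>"
      using ks by (simp add: add_mult_distrib2[symmetric])
    have r': "r dvd d i * (s - \<kappa>)"
      using dvd[OF i] r_dvd_d_kappa[OF i] by (simp add: diff_mult_distrib2 dvd_diff_nat)
    have "\<omega> (d i * (j + s - \<kappa>) + q) = a ! q" if q: "q < n" for q
    \<comment> \<open>The two given copies cover the window: letters with
      \<open>q \<ge> d i * \<kappa>\<close> lie in the later copy, the others in the earlier one. In
      each case the offset changes by a multiple of \<open>r\<close>, so the letter is the
      same.\<close>
    proof (cases "d i * \<kappa> \<le> q")
      case True
      have "\<omega> (d i * (j + s - \<kappa>) + q) = a ! (q - d i * \<kappa>)"
        using at(2)[OF i, of "q - d i * \<kappa>"] q True by (simp add: base')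
      also have "\<dots> = a ! ((q - d i * \<kappa>) mod r)"
        using q by (intro amod) simp
      also have "(q - d i * \<kappa>) mod r = q mod r"
        using r_dvd_d_kappa[OF i] True by (metis mod_eq_dvd_iff_nat le_add_diff_inverse2 diff_le_self diff_diff_cancel)
      finally show ?thesis using amod[OF q] by simp
    next
      case False
      have "d i * (s - \<kappa>) + d i * \<kappa> = d i * s"
        using ks by (simp add: add_mult_distrib2[symmetric])
      then have "d i * (s - \<kappa>) + q < n"
        using False short[OF i] by linarith
      then have "\<omega> (d i * (j + s - \<kappa>) + q) = a ! (d i * (s - \<kappa>) + q)"
        using at(1)[OF i, of "d i * (s - \<kappa>) + q"] by (simp add: base add.assoc)
      also have "\<dots> = a ! ((d i * (s - \<kappa>) + q) mod r)"
        by (rule amod) fact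
      also have "(d i * (s - \<kappa>) + q) mod r = q mod r"
        using r' by (auto elim: dvdE)
      finally show ?thesis using amod[OF q] by simp
    qed
    then show "\<omega> \<in> word_at a (d i * (j + s - \<kappa>))"
      by (simp add: word_at_def n_def)
  qed
qed

text \<open>For \<open>n \<le> j\<close> the windows of one hit start at least \<open>j\<close>
  apart and are disjoint, so mixing with gap 0 splits off the last window repeatedly.\<close>

lemma prob_hit_upper:
  assumes "n \<le> j"
  shows "prob (hit j) \<le> (1 + psi M 0) ^ l * p ^ l"
proof -
  have "prob (\<Inter>i\<in>{1..h}. word_at a (d i * j)) \<le> (1 + psi M 0) ^ h * p ^ h" if "h \<le> l" for h
    using that
  proof (induction h)
    case 0
    show ?case by simp
  next
    case (Suc h)
    let ?F = "\<Inter>i\<in>{1..h}. word_at a (d i * j)"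
    have "prob (?F \<inter> word_at a (d (Suc h) * j)) \<le> (1 + psi M 0) * (prob ?F * prob (word_at a (d (Suc h) * j)))"
    proof (rule mixing_upper[OF _ _ depends_on_INT depends_on_word_at])
      fix x y assume "x \<in> (\<Union>i\<in>{1..h}. {d i * j..<d i * j + length a})"
        and y: "y \<in> {d (Suc h) * j..<d (Suc h) * j + length a}"
      then obtain i where i: "i \<in> {1..h}" "x < d i * j + n" by (auto simp: n_def)
      have "d i + 1 \<le> d (Suc h)" using d_less[of i "Suc h"] i Suc.prems by simp
      then have "(d i + 1) * j \<le> d (Suc h) * j" by (rule mult_le_mono1)
      then show "x + 0 < y" using i y assms by simp
    qed (auto intro: depends_on_word_at)
    also have "\<dots> \<le> (1 + psi M 0) * ((1 + psi M 0) ^ h * p ^ h * p)"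
      using Suc psi_nonneg[of 0] p_bounds(1) by (intro mult_left_mono mult_mono) (auto simp: prob_word_at)
    also have "?F \<inter> word_at a (d (Suc h) * j) = (\<Inter>i\<in>{1..Suc h}. word_at a (d i * j))"
      by (auto simp: atLeastAtMostSuc_conv)
    finally show ?case by (simp add: mult_ac)
  qed
  then show ?thesis by (simp add: hit_def)
qed

text \<open>Of the hit at \<open>m\<close> only the end of the last window is kept: its last
  \<open>s \<ge> n / 2\<close> letters lie to the right of all windows of the hit at
  \<open>j\<close>, so mixing with gap 0 gives the extra factor
  \<open>exp (- \<Gamma> * n / 2)\<close>.\<close>

lemma prob_hit_pair:
  assumes j: "n \<le> j" "j < m" and far: "n \<le> 2 * (d l * (m - j))"
  shows "prob (hit j \<inter> hit m) \<le> (1 + psi M 0) ^ (l + 1) * p ^ l * exp (- \<Gamma> * real n / 2)"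
proof -
  define s where "s = min n (d l * (m - j))"
  have s: "s \<le> n" "s \<le> d l * (m - j)" "n \<le> 2 * s"
    using far by (auto simp: s_def)
  define w where "w = drop (n - s) a"
  have len: "length w = s" using s by (simp add: w_def n_def)
  have w: "w \<noteq> []" using len s n_pos by auto
  have l_in: "l \<in> {1..l}" using l by simp
  have sub: "hit m \<subseteq> word_at w (d l * m + (n - s))"
  proof
    fix \<omega> assume "\<omega> \<in> hit m"
    then have at: "\<omega> (d l * m + i) = a ! i" if "i < n" for i
      using hit_subset[OF l_in, of m] that by (auto simp: word_at_def n_def)
    show "\<omega> \<in> word_at w (d l * m + (n - s))"
      unfolding word_at_def len
    proof (intro CollectI allI impI)
      fix i assume "i < s"
      then show "\<omega> (d l * m + (n - s) + i) = w ! i"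
        using at[of "n - s + i"] s by (simp add: w_def n_def add.assoc)
    qed
  qed
  have "prob (hit j \<inter> hit m) \<le> prob (hit j \<inter> word_at w (d l * m + (n - s)))"
    using sub by (intro finite_measure_mono) auto
  also have "\<dots> \<le> (1 + psi M 0) * (prob (hit j) * prob (word_at w (d l * m + (n - s))))"
  proof (rule mixing_upper[OF _ _ depends_on_hit depends_on_word_at])
    fix x y assume "x \<in> (\<Union>i\<in>{1..l}. {d i * j..<d i * j + n})"
      and y: "y \<in> {d l * m + (n - s)..<d l * m + (n - s) + length w}"
    then obtain i where i: "i \<in> {1..l}" "x < d i * j + n" by auto
    have "d i * j \<le> d l * j" using d_bounds(2)[OF i(1)] by simp
    moreover have "d l * m = d l * j + d l * (m - j)"
      using j by (simp add: add_mult_distrib2[symmetric])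
    ultimately have "d i * j + s \<le> d l * m" using s(2) by linarith
    moreover have "d l * m + (n - s) \<le> y" using y by simp
    ultimately show "x + 0 < y" using i(2) s(1) by linarith
  qed auto
  also have "prob (word_at w (d l * m + (n - s))) \<le> exp (- \<Gamma> * real n / 2)"
  proof -
    have "\<Gamma> * real n \<le> \<Gamma> * (2 * real s)" using s Gamma_pos by (intro mult_left_mono) auto
    then have "- \<Gamma> * real s \<le> - \<Gamma> * real n / 2" by simp
    then show ?thesis
      using prob_le_exp[OF w] by (auto simp: prob_shift_word_at len intro: order_trans)
  qed
  also have "prob (hit j) \<le> (1 + psi M 0) ^ l * p ^ l"
    by (rule prob_hit_upper) fact
  finally show ?thesis
    using psi_nonneg[of 0] by (simp add: mult_ac mult_right_mono mult_left_mono)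
qed

lemma finite_near [simp]: "finite (near m)"
  by (simp add: near_def)

text \<open>Coming near a window at \<open>d i * (m - \<kappa>) \<ge> m - \<kappa>\<close> forces
  \<open>d l * j > d l * n\<close>; thus \<open>prob_hit_upper\<close> applies to near
  times.\<close>

lemma near_large:
  assumes m: "4 * d l * n < m" and j: "j \<in> near m"
  shows "n \<le> j" "1 \<le> j" "j < m"
proof -
  obtain i i' where i: "i \<in> {1..l}" "i' \<in> {1..l}" "d i * (m - \<kappa>) < d i' * j + 2 * n"
    using j by (auto simp: near_def)
  have "1 * (m - \<kappa>) \<le> d i * (m - \<kappa>)" using d_bounds[OF i(1)] by (intro mult_le_mono1)
  moreover have "d i' * j \<le> d l * j" using d_bounds[OF i(2)] by (intro mult_le_mono1)
  moreover have "1 * n \<le> d l * n" using d_bounds[of l] l by (intro mult_le_mono1) auto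
  ultimately have "d l * n < d l * j" using i(3) kappa_bounds m by linarith
  then show "n \<le> j" by simp
  show "1 \<le> j" "j < m" using j by (auto simp: near_def)
qed

text \<open>For a fixed pair of indices \<open>d i' * j\<close> lies in an interval of at most
  \<open>d i * \<kappa> + 4 * n\<close> integers, and multiplication by \<open>d i'\<close> is
  injective.\<close>

lemma card_near:
  assumes m: "\<kappa> \<le> m"
  shows "card (near m) \<le> l\<^sup>2 * (5 * d l * n)"
proof -
  define B where "B i i' = {j. d i * (m - \<kappa>) < d i' * j + 2 * n \<and> d i' * j < d i * m + 2 * n}" for i i'
  have B: "finite (B i i') \<and> card (B i i') \<le> 5 * d l * n" if i: "i \<in> {1..l}" "i' \<in> {1..l}" for i i'
  proof -
    let ?I = "{d i * (m - \<kappa>) + 1 - 2 * n..<d i * m + 2 * n}"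
    have "inj_on ((*) (d i')) (B i i')" using d_bounds[OF i(2)] by (auto simp: inj_on_def)
    moreover have sub: "(*) (d i') ` B i i' \<subseteq> ?I" by (auto simp: B_def)
    ultimately have "finite (B i i')" "card (B i i') \<le> card ?I"
      using inj_on_finite[OF _ sub] card_inj_on_le[OF _ sub] by auto
    moreover have "card ?I \<le> d i * \<kappa> + 4 * n"
      using m by (auto simp: diff_mult_distrib2)
    moreover have "d i * \<kappa> \<le> d l * n" "1 * n \<le> d l * n"
      using d_bounds[OF i(1)] kappa_bounds by (auto intro!: mult_le_mono)
    ultimately have "finite (B i i')" "card (B i i') \<le> 5 * (d l * n)" by linarith+
    then show ?thesis by (simp add: mult.assoc)
  qed
  have "near m \<subseteq> (\<Union>i\<in>{1..l}. \<Union>i'\<in>{1..l}. B i i')"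
    by (auto simp: near_def B_def)
  then have "card (near m) \<le> card (\<Union>i\<in>{1..l}. \<Union>i'\<in>{1..l}. B i i')"
    using B by (intro card_mono finite_UN_I) auto
  also have "\<dots> \<le> (\<Sum>i\<in>{1..l}. card (\<Union>i'\<in>{1..l}. B i i'))"
    by (intro card_UN_le) auto
  also have "\<dots> \<le> (\<Sum>i\<in>{1..l}. \<Sum>i'\<in>{1..l}. card (B i i'))"
    by (intro sum_mono card_UN_le) auto
  also have "\<dots> \<le> (\<Sum>i\<in>{1..l}. \<Sum>i'\<in>{1..l}. 5 * d l * n)"
    using B by (intro sum_mono) auto
  also have "\<dots> = l\<^sup>2 * (5 * d l * n)" by (simp add: power2_eq_square)
  finally show ?thesis .
qed

text \<open>If \<open>2 * (d l * (m - j)) < n\<close>, then \<open>hit_close\<close> would make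
  \<open>m - \<kappa>\<close> a hit, so the events exclude each other; otherwise
  \<open>prob_hit_pair\<close> applies.\<close>

lemma prob_clump_hit:
  assumes m: "4 * d l * n < m" and j: "j \<in> near m"
  shows "prob (clump_start m \<inter> hit j) \<le> (1 + psi M 0) ^ (l + 1) * p ^ l * exp (- \<Gamma> * real n / 2)"
proof (cases "2 * (d l * (m - j)) < n")
  case True
  have "clump_start m \<inter> hit j = {}"
    using hit_close[of _ j "m - j"] near_large[OF m j] True by (auto simp: clump_start_def)
  then show ?thesis using psi_nonneg[of 0] p_bounds by simp
next
  case False
  have "prob (clump_start m \<inter> hit j) \<le> prob (hit j \<inter> hit m)"
    by (intro finite_measure_mono) (auto simp: clump_start_def)
  also have "\<dots> \<le> (1 + psi M 0) ^ (l + 1) * p ^ l * exp (- \<Gamma> * real n / 2)"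
    using near_large[OF m j] False by (intro prob_hit_pair) auto
  finally show ?thesis .
qed

text \<open>For large \<open>m\<close>, up to a mixing error, the probability that
  \<open>m - \<kappa>\<close> and \<open>m\<close> are both hits.\<close>

definition q :: real where "q = (\<Prod>i\<in>{1..l}. c i)"

lemma c_bounds: "0 \<le> c i" "c i \<le> p"
  by (auto simp: c_def p_def word_at_0 intro!: finite_measure_mono)
     (metis word_at_0 sets_word_at)

lemma q_bounds: "0 \<le> q" "q \<le> p ^ l"
proof -
  show "0 \<le> q" by (simp add: q_def prod_nonneg c_bounds)
  have "q \<le> (\<Prod>i\<in>{1..l}. p)" unfolding q_def by (intro prod_mono) (simp add: c_bounds)
  then show "q \<le> p ^ l" by simp
qed

text \<open>A clump start at \<open>m\<close> is the hit at \<open>m\<close> minus the simultaneous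
  hits at \<open>m - \<kappa>\<close> and \<open>m\<close>. Both are intersections of
  \<open>l\<close> events in the same windows, so \<open>mixing_blocks_error\<close> is used twice,
  whence \<open>72 = 2 * 36\<close>.\<close>

lemma prob_clump_avoid:
  assumes m: "4 * d l * n < m" and J: "J \<subseteq> {1..<m} - near m"
  defines "E \<equiv> \<Inter>j\<in>J. - hit j"
  shows "\<bar>prob (clump_start m \<inter> E) - (p ^ l - q) * prob E\<bar> \<le> 72 * real l * psi M n * p ^ l"
proof -
  let ?u = "\<lambda>i. d i * (m - \<kappa>)" and ?v = "\<lambda>i. d i * m + n"
  let ?K = "\<Union>j\<in>J. \<Union>i\<in>{1..l}. {d i * j..<d i * j + n}"
  have "1 * n \<le> d l * n" using d_bounds[of l] l by (intro mult_le_mono1) auto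
  then have km: "\<kappa> < m" "n \<le> m" using kappa_bounds m by linarith+
  have finJ: "finite J" using J by (rule finite_subset) simp
  have E: "finite ?K" "depends_on ?K E"
    using finJ depends_on_avoid[of J] by (auto simp: E_def)
  have uv: "?u i < ?v i" for i
  proof -
    have "?u i \<le> d i * m" by simp
    then show ?thesis using n_pos by linarith
  qed
  have u: "?u i + d i * \<kappa> = d i * m" for i
    using km by (simp add: add_mult_distrib2[symmetric])
  \<comment> \<open>The positions \<open>d i * m\<close> differ by at least
    \<open>m > 4 * d l * n\<close>, which exceeds the extension
    \<open>d j * \<kappa> \<le> d l * n\<close> to the left plus the window length and the
    gap.\<close>
  have order: "?v i + n \<le> ?u j" if "1 \<le> i" "i < j" "j \<le> l" for i j
  proof -
    have "(d i + 1) * m \<le> d j * m" using d_less[OF that] by (intro mult_le_mono1) simp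
    then have "d i * m + m \<le> d j * m" by simp
    moreover have "d j * \<kappa> \<le> d l * n"
      using d_bounds[of j] that kappa_bounds by (intro mult_le_mono) auto
    moreover have "4 * (d l * n) < m" using m by (simp add: mult.assoc)
    ultimately show ?thesis
      using u[of j] \<open>1 * n \<le> d l * n\<close> by linarith
  qed
  have sep: "?v i + n \<le> ?u j \<or> ?v j + n \<le> ?u i" if "i \<in> {1..l}" "j \<in> {1..l}" "i \<noteq> j" for i j
    using order[of i j] order[of j i] that by (auto simp: nat_neq_iff)
  have gap: "y + n < ?u i \<or> ?v i + n \<le> y" if i: "i \<in> {1..l}" and y: "y \<in> ?K" for i y
  proof -
    obtain j i' where ji: "j \<in> J" "i' \<in> {1..l}" "d i' * j \<le> y" "y < d i' * j + n" using y by auto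
    then have "j \<in> {1..<m}" "j \<notin> near m" using J by auto
    then have "\<not> (d i * (m - \<kappa>) < d i' * j + 2 * n \<and> d i' * j < d i * m + 2 * n)"
      using i ji(2) unfolding near_def by blast
    then show ?thesis using ji by linarith
  qed
  note error = mixing_blocks_error[of "{1..l}" l n ?u ?v _ ?K E, OF _ _ _ uv _ sep E gap]
  have dep: "depends_on {?u i..<?v i} (word_at a (d i * m))"
    "depends_on {?u i..<?v i} (word_at a (d i * (m - \<kappa>)))" for i
    by (rule depends_on_mono[OF depends_on_word_at]; auto simp: n_def diff_mult_distrib2)+
  have dep2: "depends_on {?u i..<?v i} (word_at a (d i * (m - \<kappa>)) \<inter> word_at a (d i * m))" for i
    using depends_on_Int[OF dep(2)[of i] dep(1)[of i]] by simp
  have c: "prob (word_at a (d i * (m - \<kappa>)) \<inter> word_at a (d i * m)) = c i" for i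
    using prob_shift_word_at_Int[of a "?u i" 0 a "d i * \<kappa>"] by (simp add: c_def u)
  have 1: "\<bar>prob (E \<inter> hit m) - prob E * p ^ l\<bar> \<le> 36 * real l * psi M n * p ^ l"
    using error[of "\<lambda>i. word_at a (d i * m)"] dep(1) psi_small
    by (simp add: hit_def prob_word_at n_def)
  have "hit (m - \<kappa>) \<inter> hit m = (\<Inter>i\<in>{1..l}. word_at a (d i * (m - \<kappa>)) \<inter> word_at a (d i * m))"
    by (auto simp: hit_def)
  then have 2: "\<bar>prob (E \<inter> (hit (m - \<kappa>) \<inter> hit m)) - prob E * q\<bar> \<le> 36 * real l * psi M n * q"
    using error[of "\<lambda>i. word_at a (d i * (m - \<kappa>)) \<inter> word_at a (d i * m)"] dep2 psi_small
    by (simp add: c q_def n_def)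
  have "36 * real l * psi M n * q \<le> 36 * real l * psi M n * p ^ l"
    using q_bounds psi_nonneg by (intro mult_left_mono) auto
  moreover have "prob (clump_start m \<inter> E) = prob (E \<inter> hit m) - prob (E \<inter> (hit (m - \<kappa>) \<inter> hit m))"
  proof -
    have "clump_start m \<inter> E = (E \<inter> hit m) - (E \<inter> (hit (m - \<kappa>) \<inter> hit m))"
      by (auto simp: clump_start_def)
    then show ?thesis
      using finJ by (simp add: E_def) (subst finite_measure_Diff; auto)
  qed
  ultimately show ?thesis
    using 1 2 by (simp add: abs_le_iff algebra_simps)
qed

end

section \<open>Elementary exponential estimates\<close>

lemma exp_minus_lipschitz:
  fixes x y :: real
  assumes "0 \<le> x" "0 \<le> y"
  shows "\<bar>exp (- x) - exp (- y)\<bar> \<le> \<bar>x - y\<bar>"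
proof -
  have *: "\<bar>exp (- x) - exp (- y)\<bar> \<le> \<bar>x - y\<bar>" if "0 \<le> x" "x \<le> y" for x y :: real
  proof -
    have "1 - exp (- (y - x)) \<le> y - x"
      using exp_ge_add_one_self[of "- (y - x)"] by linarith
    have "exp (- x) - exp (- y) = exp (- x) * (1 - exp (- (y - x)))"
      by (simp add: algebra_simps exp_add[symmetric])
    also have "\<dots> \<le> 1 * (y - x)"
      using that \<open>1 - exp (- (y - x)) \<le> y - x\<close> by (intro mult_mono) auto
    finally show ?thesis using that by simp
  qed
  show ?thesis
    using *[of x y] *[of y x] assms by (cases "x \<le> y") (auto simp: abs_minus_commute)
qed

text \<open>The difference of \<open>N\<close>-th powers of two numbers in the unit interval is at
  most \<open>N\<close> times their difference; for \<open>N = 1\<close> the bound comes from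
  \<open>exp (- x) \<le> 1 / (1 + x)\<close>.\<close>

lemma power_exp_error:
  fixes x :: real
  assumes "0 \<le> x" "x \<le> 1"
  shows "\<bar>(1 - x) ^ N - exp (- (x * real N))\<bar> \<le> real N * x\<^sup>2"
proof -
  have "1 + x \<le> exp x" by simp
  then have "inverse (exp x) \<le> inverse (1 + x)"
    using assms by (intro le_imp_inverse_le) auto
  also have "\<dots> \<le> 1 - x + x\<^sup>2"
    using assms by (simp add: field_simps power2_eq_square)
  finally have "\<bar>(1 - x) - exp (- x)\<bar> \<le> x\<^sup>2"
    using exp_ge_add_one_self[of "- x"] by (simp add: exp_minus)
  then have "real N * norm ((1 - x) - exp (- x)) \<le> real N * x\<^sup>2"
    by (intro mult_left_mono) auto
  moreover have "norm ((1 - x) ^ N - exp (- x) ^ N) \<le> real N * norm ((1 - x) - exp (- x))"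
    using assms by (intro norm_power_diff) auto
  moreover have "exp (- x) ^ N = exp (- (x * real N))"
    by (simp add: exp_of_nat_mult[symmetric] mult.commute)
  ultimately show ?thesis by simp
qed

section \<open>The recursion for the probability of no hit\<close>

context multiple_recurrence
begin

text \<open>The first factor in the bracket bounds the number of near times. For each of them the
  two summands account for a clump start with a hit there and for a hit there alone; the last term
  is the mixing error.\<close>

definition step_error :: real where
  "step_error = p ^ l * (real (l\<^sup>2 * (5 * d l * n)) * ((1 + psi M 0) ^ (l + 1) * exp (- \<Gamma> * real n / 2) + p)
    + 72 * real l * psi M n)"

lemma prob_no_hit_step:
  assumes m: "4 * d l * n < m"
  shows "\<bar>prob (no_hit m) - (1 - (p ^ l - q)) * prob (no_hit (m - 1))\<bar> \<le> step_error"
proof -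
  define E where "E = (\<Inter>j\<in>{1..<m} - near m. - hit j)"
  define D where "D = real (l\<^sup>2 * (5 * d l * n))"
  define b where "b = (1 + psi M 0) ^ (l + 1) * p ^ l * exp (- \<Gamma> * real n / 2)"
  have "1 * n \<le> d l * n" using d_bounds[of l] l by (intro mult_le_mono1) auto
  then have km: "1 \<le> \<kappa>" "\<kappa> < m" using kappa_bounds m by linarith+
  have D: "real (card (near m)) \<le> D"
    using card_near[of m] km unfolding D_def by (intro of_nat_mono) auto
  have sets: "E \<in> sets M" by (simp add: E_def)
  \<comment> \<open>Without a hit up to \<open>m - 1\<close> there is none at
    \<open>m - \<kappa> \<ge> 1\<close>, so a first hit at \<open>m\<close> is a clump
    start.\<close>
  have eq: "no_hit m = no_hit (m - 1) - clump_start m \<inter> no_hit (m - 1)"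
  proof -
    have "m - \<kappa> \<in> {1..m - 1}" using km by auto
    moreover have "{1..m} = insert m {1..m - 1}" using km by auto
    ultimately show ?thesis unfolding no_hit_def clump_start_def by auto
  qed
  have N: "no_hit (m - 1) = E - (\<Union>j\<in>near m. hit j)"
  proof -
    have "{1..m - 1} = ({1..<m} - near m) \<union> near m" using km by (auto simp: near_def)
    then show ?thesis unfolding no_hit_def E_def by (simp add: ball_Un) blast
  qed
  have split: "prob (no_hit m) = prob (no_hit (m - 1)) - prob (clump_start m \<inter> no_hit (m - 1))"
    by (subst eq) (subst finite_measure_Diff; simp)
  \<comment> \<open>Used with \<open>F = clump_start m\<close> for the joint probability and with
    \<open>F = UNIV\<close> for that of \<open>E\<close> alone.\<close>
  have diff: "prob (F \<inter> no_hit (m - 1)) \<le> prob (F \<inter> E) \<and>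
      prob (F \<inter> E) \<le> prob (F \<inter> no_hit (m - 1)) + (\<Sum>j\<in>near m. prob (F \<inter> hit j))"
    if "F \<in> sets M" for F
  proof
    show "prob (F \<inter> no_hit (m - 1)) \<le> prob (F \<inter> E)"
      using that sets N by (intro finite_measure_mono) blast+
    have "prob (F \<inter> E) \<le> prob (F \<inter> no_hit (m - 1) \<union> (\<Union>j\<in>near m. F \<inter> hit j))"
      using that sets N by (intro finite_measure_mono) auto
    also have "\<dots> \<le> prob (F \<inter> no_hit (m - 1)) + prob (\<Union>j\<in>near m. F \<inter> hit j)"
      using that by (intro measure_Un_le) auto
    also have "prob (\<Union>j\<in>near m. F \<inter> hit j) \<le> (\<Sum>j\<in>near m. prob (F \<inter> hit j))"
      using that by (intro measure_UNION_le) auto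
    finally show "prob (F \<inter> E) \<le> prob (F \<inter> no_hit (m - 1)) + (\<Sum>j\<in>near m. prob (F \<inter> hit j))"
      by simp
  qed
  have "(\<Sum>j\<in>near m. prob (clump_start m \<inter> hit j)) \<le> (\<Sum>j\<in>near m. b)"
    unfolding b_def by (intro sum_mono prob_clump_hit m)
  also have "\<dots> \<le> D * b"
    using D psi_nonneg[of 0] p_bounds by (auto simp: b_def intro!: mult_right_mono)
  finally have 1: "\<bar>prob (clump_start m \<inter> E) - prob (clump_start m \<inter> no_hit (m - 1))\<bar> \<le> D * b"
    using diff[OF sets_clump_start[of m]] by simp
  have "(\<Sum>j\<in>near m. prob (UNIV \<inter> hit j)) \<le> (\<Sum>j\<in>near m. p)"
    by (intro sum_mono) (simp add: prob_hit_le)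
  also have "\<dots> \<le> D * p"
    using D p_bounds by (auto intro!: mult_right_mono)
  finally have "\<bar>prob E - prob (no_hit (m - 1))\<bar> \<le> D * p"
    using diff[of UNIV] sets.top[of M] by simp
  then have "(p ^ l - q) * \<bar>prob E - prob (no_hit (m - 1))\<bar> \<le> p ^ l * (D * p)"
    using q_bounds by (intro mult_mono) auto
  then have 2: "\<bar>(p ^ l - q) * prob E - (p ^ l - q) * prob (no_hit (m - 1))\<bar> \<le> p ^ l * (D * p)"
    using q_bounds by (simp add: right_diff_distrib[symmetric] abs_mult)
  have 3: "\<bar>prob (clump_start m \<inter> E) - (p ^ l - q) * prob E\<bar> \<le> 72 * real l * psi M n * p ^ l"
    unfolding E_def by (rule prob_clump_avoid[OF m]) simp
  have "\<bar>prob (no_hit m) - (1 - (p ^ l - q)) * prob (no_hit (m - 1))\<bar>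
      = \<bar>(prob (clump_start m \<inter> E) - prob (clump_start m \<inter> no_hit (m - 1)))
        - (prob (clump_start m \<inter> E) - (p ^ l - q) * prob E)
        - ((p ^ l - q) * prob E - (p ^ l - q) * prob (no_hit (m - 1)))\<bar>"
    unfolding split by (simp add: algebra_simps)
  also have "\<dots> \<le> D * b + 72 * real l * psi M n * p ^ l + p ^ l * (D * p)"
    using 1 2 3 by linarith
  also have "\<dots> = step_error"
    by (simp add: step_error_def D_def b_def algebra_simps)
  finally show ?thesis .
qed

lemma clump_rate: "0 \<le> p ^ l - q" "p ^ l - q \<le> p ^ l" "p ^ l \<le> p"
  using q_bounds p_bounds l power_decreasing[of 1 l p] by auto

lemma step_error_nonneg: "0 \<le> step_error"
  unfolding step_error_def using p_bounds(1) psi_nonneg by simp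

text \<open>The factor \<open>1 - (p ^ l - q)\<close> lies in the unit interval, so the errors of
  the steps just add up. The first \<open>4 * d l * n\<close> times, which the step does not cover,
  contribute at most \<open>p\<close> each.\<close>

lemma prob_no_hit:
  "\<bar>prob (no_hit m) - (1 - (p ^ l - q)) ^ m\<bar> \<le> real (4 * d l * n) * p + real m * step_error"
proof (induction m)
  case 0
  have "no_hit 0 = UNIV" by (simp add: no_hit_def)
  then show ?case
    using prob_space p_bounds(1) by simp
next
  case (Suc m)
  let ?x = "1 - (p ^ l - q)"
  have x: "0 \<le> ?x" "?x \<le> 1" using clump_rate p_bounds by auto
  show ?case
  proof (cases "4 * d l * n < Suc m")
    case True
    have "prob (no_hit (Suc m)) - ?x ^ Suc m =
        (prob (no_hit (Suc m)) - ?x * prob (no_hit m)) + ?x * (prob (no_hit m) - ?x ^ m)"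
      by (simp add: algebra_simps)
    moreover have "\<bar>?x * (prob (no_hit m) - ?x ^ m)\<bar> \<le> \<bar>prob (no_hit m) - ?x ^ m\<bar>"
      using x by (simp add: abs_mult mult_left_le_one_le)
    moreover have "\<bar>prob (no_hit (Suc m)) - ?x * prob (no_hit m)\<bar> \<le> step_error"
      using prob_no_hit_step[OF True] by simp
    ultimately have "\<bar>prob (no_hit (Suc m)) - ?x ^ Suc m\<bar>
        \<le> step_error + (real (4 * d l * n) * p + real m * step_error)"
      using Suc.IH by linarith
    then show ?thesis by (simp add: algebra_simps)
  next
    case False
    \<comment> \<open>In the initial range both quantities lie between
      \<open>1 - real (Suc m) * p\<close> and 1.\<close>
    then have le: "real (Suc m) * p \<le> real (4 * d l * n) * p"
      using p_bounds by (intro mult_right_mono of_nat_mono) auto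
    have "1 + real (Suc m) * (- y) \<le> (1 + (- y)) ^ Suc m" if "y \<le> 1" for y :: real
      by (intro Bernoulli_inequality) (use that in simp)
    from this[of "p ^ l - q"] have "1 - real (Suc m) * (p ^ l - q) \<le> ?x ^ Suc m"
      using x by (simp only: minus_mult_right[symmetric] add_uminus_conv_diff)
    moreover have "real (Suc m) * (p ^ l - q) \<le> real (Suc m) * p"
      using clump_rate by (intro mult_left_mono) auto
    moreover have "1 - prob (no_hit (Suc m)) \<le> real (Suc m) * p"
    proof -
      have "1 - prob (no_hit (Suc m)) = prob (UNIV - no_hit (Suc m))"
        using prob_compl[of "no_hit (Suc m)"] by simp
      also have "UNIV - no_hit (Suc m) = (\<Union>j\<in>{1..Suc m}. hit j)"
        by (auto simp: no_hit_def)
      also have "prob \<dots> \<le> (\<Sum>j\<in>{1..Suc m}. prob (hit j))"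
        by (intro measure_UNION_le) auto
      also have "\<dots> \<le> (\<Sum>j\<in>{1..Suc m}. p)" by (intro sum_mono prob_hit_le)
      finally show ?thesis by simp
    qed
    moreover have "?x ^ Suc m \<le> 1" using x by (intro power_le_one)
    moreover have "prob (no_hit (Suc m)) \<le> 1" by simp
    moreover have "0 \<le> real (Suc m) * step_error" using step_error_nonneg by simp
    ultimately show ?thesis using le by linarith
  qed
qed

section \<open>The parameter \<open>\<rho>\<close> and the hitting time\<close>

definition \<rho> :: real where "\<rho> = rho M l d a"

text \<open>If \<open>d l * \<kappa> \<le> n\<close>, the copies of \<open>a\<close> at 0 and
  \<open>d i * \<kappa>\<close> overlap or touch and, as \<open>r\<close> divides the shift,
  together spell the periodic continuation; then \<open>q = \<rho> * p ^ l\<close>. Otherwise the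
  last pair is disjoint, so the bound on \<open>q\<close> gains a factor \<open>p\<close>, and
  \<open>0 \<le> \<rho> * p ^ l \<le> q\<close> bounds the difference by \<open>q\<close>.\<close>

lemma rho_bounds:
  "\<rho> \<le> 1" "\<bar>q - \<rho> * p ^ l\<bar> \<le> (1 + psi M 0) * p ^ l * p"
proof -
  define e where "e i = prob (periodic_cylinder (take r a) (n + d i * \<kappa>) \<inter> cylinder a)" for i
  have rho: "\<rho> = (\<Prod>i\<in>{1..l}. e i / p)"
    by (simp add: \<rho>_def rho_def Let_def cond_prob_def e_def n_def r_def \<kappa>_def p_def Int_def)
  have len: "length (take r a) = r" "take r a \<noteq> []"
    using r(2,3) a by (auto simp: n_def)
  have mod: "take r a ! (i mod r) = a ! (i mod r)" for i
    using r(2) by (simp add: less_imp_le Suc_le_eq)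
  have per: "periodic_cylinder (take r a) m = {\<omega>. \<forall>i<m. \<omega> i = a ! (i mod r)}" for m
    using periodic_cylinder_eq[OF len(2), of m] unfolding len(1) mod .
  have amod: "a ! i = a ! (i mod r)" if "i < n" for i
    using period_mod[OF r(1)] that by (simp add: n_def)
  have sub: "periodic_cylinder (take r a) (n + d i * \<kappa>) \<inter> cylinder a
      \<subseteq> word_at a 0 \<inter> word_at a (d i * \<kappa>)" if "i \<in> {1..l}" for i
  proof
    fix \<omega> assume \<omega>: "\<omega> \<in> periodic_cylinder (take r a) (n + d i * \<kappa>) \<inter> cylinder a"
    have "\<omega> (d i * \<kappa> + j) = a ! j" if j: "j < n" for j
    proof -
      have "\<omega> (d i * \<kappa> + j) = a ! ((d i * \<kappa> + j) mod r)" using \<omega> j by (simp add: per)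
      also have "(d i * \<kappa> + j) mod r = j mod r"
        using r_dvd_d_kappa[OF \<open>i \<in> {1..l}\<close>] by (auto elim: dvdE)
      finally show ?thesis using amod[OF j] by simp
    qed
    then show "\<omega> \<in> word_at a 0 \<inter> word_at a (d i * \<kappa>)"
      using \<omega> by (simp add: word_at_0) (simp add: word_at_def n_def)
  qed
  have sup: "word_at a 0 \<inter> word_at a (d i * \<kappa>)
      \<subseteq> periodic_cylinder (take r a) (n + d i * \<kappa>) \<inter> cylinder a"
    if i: "i \<in> {1..l}" "d i * \<kappa> \<le> n" for i
  proof
    fix \<omega> assume \<omega>: "\<omega> \<in> word_at a 0 \<inter> word_at a (d i * \<kappa>)"
    have "\<omega> j = a ! (j mod r)" if j: "j < n + d i * \<kappa>" for j
    proof (cases "j < n")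
      case True
      then show ?thesis using \<omega> amod[OF True] by (simp add: word_at_def n_def)
    next
      case False
      then have ge: "d i * \<kappa> \<le> j" using i by simp
      have "j - d i * \<kappa> < n" using j ge by simp
      then have "\<omega> (d i * \<kappa> + (j - d i * \<kappa>)) = a ! (j - d i * \<kappa>)"
        using \<omega> unfolding word_at_def n_def by blast
      also have "\<dots> = a ! ((j - d i * \<kappa>) mod r)"
        using j ge by (intro amod) simp
      also have "(j - d i * \<kappa>) mod r = j mod r"
        using r_dvd_d_kappa[OF i(1)] ge by (metis mod_eq_dvd_iff_nat le_add_diff_inverse2 diff_le_self diff_diff_cancel)
      finally show ?thesis using ge by simp
    qed
    then show "\<omega> \<in> periodic_cylinder (take r a) (n + d i * \<kappa>) \<inter> cylinder a"
      using \<omega> by (simp add: per word_at_0)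
  qed
  have e: "0 \<le> e i" "e i \<le> c i" if "i \<in> {1..l}" for i
    using sub[OF that] by (auto simp: e_def c_def intro!: finite_measure_mono)
  have e_p: "e i \<le> p" if "i \<in> {1..l}" for i
    using e(2)[OF that] c_bounds(2)[of i] by simp
  show "\<rho> \<le> 1" unfolding rho using e e_p p_bounds by (intro prod_le_1) auto
  have rp: "\<rho> * p ^ l = (\<Prod>i\<in>{1..l}. e i)"
    using p_bounds(1) by (simp add: rho prod_dividef)
  have le: "\<rho> * p ^ l \<le> q" "0 \<le> \<rho> * p ^ l"
    unfolding rp q_def using e by (auto intro!: prod_mono prod_nonneg)
  show "\<bar>q - \<rho> * p ^ l\<bar> \<le> (1 + psi M 0) * p ^ l * p"
  proof (cases "d l * \<kappa> \<le> n")
    case True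
    have "e i = c i" if i: "i \<in> {1..l}" for i
    proof -
      have "d i * \<kappa> \<le> d l * \<kappa>" using d_bounds(2)[OF i] by simp
      then have "d i * \<kappa> \<le> n" using True by linarith
      from subset_antisym[OF sub[OF i] sup[OF i this]] show ?thesis
        by (simp add: e_def c_def)
    qed
    then have "\<rho> * p ^ l = q" by (simp add: rp q_def)
    then show ?thesis using p_bounds psi_nonneg[of 0] by simp
  next
    case False
    have "c l \<le> (1 + psi M 0) * (prob (word_at a 0) * prob (word_at a (d l * \<kappa>)))"
      unfolding c_def using False
      by (intro mixing_upper[OF _ _ depends_on_word_at depends_on_word_at]) (auto simp: n_def)
    then have cl: "c l \<le> (1 + psi M 0) * p * p" by (simp add: prob_word_at)
    have "q = c l * (\<Prod>i\<in>{1..l} - {l}. c i)"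
      unfolding q_def using l by (intro prod.remove) auto
    also have "\<dots> \<le> (1 + psi M 0) * p * p * (\<Prod>i\<in>{1..l} - {l}. p)"
      using cl c_bounds p_bounds psi_nonneg[of 0] by (intro mult_mono prod_mono prod_nonneg) auto
    also have "(\<Prod>i\<in>{1..l} - {l}. p) = p ^ (l - 1)" using l by simp
    also have "(1 + psi M 0) * p * p * p ^ (l - 1) = (1 + psi M 0) * p ^ l * p"
      using l by (cases l) auto
    finally show ?thesis using le by simp
  qed
qed

text \<open>For integers, exceeding \<open>t / p ^ l\<close> means exceeding its floor.\<close>

lemma no_hit_hitting_time:
  assumes "0 \<le> t"
  shows "{\<omega>. ereal (p ^ l) * ereal_of_enat (hitting_time l d (cylinder a) \<omega>) > ereal t}
    = no_hit (nat \<lfloor>t / p ^ l\<rfloor>)"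
proof (rule Collect_cong[THEN trans[OF _ no_hit_def[symmetric]]])
  fix \<omega>
  let ?N = "nat \<lfloor>t / p ^ l\<rfloor>"
  define K where "K = {k. 1 \<le> k \<and> \<omega> \<in> hit k}"
  have P: "0 < p ^ l" using p_bounds by simp
  have "(\<Prod>i=1..l. indicator (cylinder a) ((shift ^^ (d i * k)) \<omega>)) = (1 :: nat) \<longleftrightarrow> \<omega> \<in> hit k" for k
    by (subst prod_eq_1_iff) (auto simp: hit_def vimage_shift_cylinder[symmetric] indicator_def)
  then have \<tau>: "hitting_time l d (cylinder a) \<omega> = Inf (enat ` K)"
    by (simp add: hitting_time_def K_def image_Collect)
  have N: "(\<forall>j\<in>{1..?N}. \<omega> \<notin> hit j) \<longleftrightarrow> (\<forall>k\<in>K. ?N < k)"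
    by (auto simp: K_def not_le[symmetric])
  show "ereal t < ereal (p ^ l) * ereal_of_enat (hitting_time l d (cylinder a) \<omega>)
      \<longleftrightarrow> (\<forall>j\<in>{1..?N}. \<omega> \<notin> hit j)"
  proof (cases "K = {}")
    \<comment> \<open>Without any hit the infimum is \<infinity>, and its product with
      \<open>p ^ l\<close> is \<infinity> because \<open>p ^ l > 0\<close>.\<close>
    case True
    then show ?thesis using p_bounds(1) unfolding N \<tau> by (simp add: top_enat_def)
  next
    case False
    define k where "k = (LEAST k. k \<in> K)"
    have k: "k \<in> K" "\<And>j. j \<in> K \<Longrightarrow> k \<le> j"
      unfolding k_def using False by (auto intro: LeastI Least_le)
    have "Inf (enat ` K) = enat k"
      using k by (intro antisym Inf_lower Inf_greatest) auto
    moreover have "(\<forall>j\<in>K. ?N < j) \<longleftrightarrow> ?N < k"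
      using k by (auto intro: less_le_trans)
    moreover have "?N < k \<longleftrightarrow> t / p ^ l < real k"
      using assms P by (simp add: nat_less_iff floor_less_iff)
    ultimately show ?thesis
      using P unfolding N \<tau> by (simp add: pos_divide_less_eq mult.commute)
  qed
qed

text \<open>Four comparisons: the probability of no hit with \<open>(1 - x) ^ N\<close>, this with
  \<open>exp (- (x * N))\<close>, then \<open>N\<close> with \<open>t / p ^ l\<close>, and finally
  \<open>x / p ^ l\<close> with \<open>1 - \<rho>\<close>.\<close>

lemma hitting_time_error:
  assumes t: "0 \<le> t"
  shows "\<bar>prob (no_hit (nat \<lfloor>t / p ^ l\<rfloor>)) - exp (- (1 - \<rho>) * t)\<bar>
    \<le> (t + 1) * (1 + psi M 0) ^ (l + 1) *
      (20 * (real l)\<^sup>2 * real (d l) * real n * exp (- \<Gamma> * real n / 2) + 72 * real l * psi M n)"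
proof -
  define N where "N = nat \<lfloor>t / p ^ l\<rfloor>"
  define x where "x = p ^ l - q"
  define e where "e = exp (- \<Gamma> * real n / 2)"
  define B where "B = (real l)\<^sup>2 * real (d l) * real n"
  define Y where "Y = (1 + psi M 0) ^ (l + 1)"
  define z where "z = real l * psi M n"
  have P: "0 < p ^ l" using p_bounds by simp
  have x: "0 \<le> x" "x \<le> p ^ l" "x \<le> 1" using clump_rate p_bounds by (auto simp: x_def)
  have "real N \<le> t / p ^ l" "t / p ^ l < real N + 1"
    using t P by (auto simp: N_def)
  then have N: "real N * p ^ l \<le> t" "t \<le> (real N + 1) * p ^ l"
    using P by (simp_all add: field_simps)
  \<comment> \<open>\<open>e\<close> is the square root of the bound
    \<open>exp (- \<Gamma> * n)\<close> on \<open>p\<close> and serves as the common bound for all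
    exponentially small terms.\<close>
  have pe: "p \<le> e"
    using p_bounds(2) Gamma_pos by (auto simp: e_def intro: order_trans)
  have Y: "1 \<le> Y" "1 + psi M 0 \<le> Y"
    unfolding Y_def using psi_nonneg[of 0] self_le_power[of "1 + psi M 0" "l + 1"] by (auto simp del: power_Suc)
  have "(1::real) \<le> (real l)\<^sup>2" "1 \<le> real (d l)" "1 \<le> real n"
    using l d_bounds[of l] n_pos by (auto simp: one_le_power)
  then have "1 * 1 \<le> real (d l) * real n" "1 * (real (d l) * real n) \<le> (real l)\<^sup>2 * (real (d l) * real n)"
    by (intro mult_mono mult_right_mono; simp)+
  then have B: "1 \<le> B" "real (d l) * real n \<le> B"
    unfolding B_def by (simp_all add: mult.assoc)
  have z: "0 \<le> z" using psi_nonneg by (simp add: z_def)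
  have 1: "\<bar>prob (no_hit N) - (1 - x) ^ N\<bar> \<le> 4 * B * e + t * (5 * B * (Y * e + e) + 72 * z)"
  proof -
    have "real (4 * d l * n) * p \<le> 4 * B * e"
    proof -
      have "real (4 * d l * n) * p = 4 * (real (d l) * real n * p)" by simp
      also have "\<dots> \<le> 4 * (B * e)" using B pe p_bounds by (intro mult_left_mono mult_mono) auto
      finally show ?thesis by simp
    qed
    moreover have "real N * step_error \<le> t * (5 * B * (Y * e + e) + 72 * z)"
    proof -
      have "real N * step_error = real N * p ^ l * (5 * B * (Y * e + p) + 72 * z)"
        by (simp add: step_error_def B_def Y_def e_def z_def)
      also have "\<dots> \<le> t * (5 * B * (Y * e + e) + 72 * z)"
        using N t pe B Y z p_bounds
        by (intro mult_mono add_mono mult_left_mono add_nonneg_nonneg mult_nonneg_nonneg) (auto simp: e_def)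
      finally show ?thesis .
    qed
    ultimately show ?thesis using prob_no_hit[of N] by (simp add: x_def)
  qed
  have 2: "\<bar>(1 - x) ^ N - exp (- (x * real N))\<bar> \<le> t * e"
  proof -
    have "real N * x\<^sup>2 \<le> real N * p ^ l * e"
    proof -
      have "x * x \<le> p ^ l * e" using x clump_rate pe by (intro mult_mono) auto
      then show ?thesis by (simp add: power2_eq_square mult.assoc mult_left_mono)
    qed
    also have "\<dots> \<le> t * e" using N by (intro mult_right_mono) (auto simp: e_def)
    finally show ?thesis using power_exp_error[OF x(1,3), of N] by simp
  qed
  have 3: "\<bar>exp (- (x * real N)) - exp (- (x * (t / p ^ l)))\<bar> \<le> e"
  proof -
    have "\<bar>x * real N - x * (t / p ^ l)\<bar> = \<bar>x\<bar> * \<bar>real N - t / p ^ l\<bar>"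
      by (simp only: right_diff_distrib[symmetric] abs_mult)
    also have "\<dots> = x * (t / p ^ l - real N)"
      using x \<open>real N \<le> t / p ^ l\<close> by simp
    also have "\<dots> \<le> p ^ l * 1"
      using x \<open>real N \<le> t / p ^ l\<close> \<open>t / p ^ l < real N + 1\<close> by (intro mult_mono) auto
    also have "\<dots> \<le> e" using clump_rate pe by simp
    finally show ?thesis
      using exp_minus_lipschitz[of "x * real N" "x * (t / p ^ l)"] x t P by simp
  qed
  have 4: "\<bar>exp (- (x * (t / p ^ l))) - exp (- ((1 - \<rho>) * t))\<bar> \<le> Y * e * t"
  proof -
    have "x / p ^ l = 1 - q / p ^ l" "(q - \<rho> * p ^ l) / p ^ l = q / p ^ l - \<rho>"
      using p_bounds(1) by (simp_all add: x_def diff_divide_distrib)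
    moreover have "x * (t / p ^ l) = x / p ^ l * t" by simp
    ultimately have "x * (t / p ^ l) - (1 - \<rho>) * t = - ((q - \<rho> * p ^ l) / p ^ l * t)"
      by (simp only: left_diff_distrib)
    then have "\<bar>x * (t / p ^ l) - (1 - \<rho>) * t\<bar> = \<bar>q - \<rho> * p ^ l\<bar> / p ^ l * t"
      using P t by (simp add: abs_mult)
    also have "\<dots> \<le> ((1 + psi M 0) * p ^ l * p) / p ^ l * t"
      using P t rho_bounds(2) by (intro mult_right_mono divide_right_mono) auto
    also have "\<dots> = (1 + psi M 0) * p * t" using p_bounds(1) by simp
    also have "\<dots> \<le> Y * e * t"
      using Y pe p_bounds t by (intro mult_right_mono mult_mono) auto
    finally show ?thesis
      using exp_minus_lipschitz[of "x * (t / p ^ l)" "(1 - \<rho>) * t"] x t P rho_bounds(1) by simp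
  qed
  have e: "0 \<le> e" by (simp add: e_def)
  \<comment> \<open>Since \<open>B\<close> and \<open>Y\<close> are at least 1, every error reduces
    to a multiple of \<open>Y * (B * e)\<close> or of \<open>Y * z\<close>.\<close>
  have Be: "e \<le> B * e" "B * e \<le> Y * (B * e)" "e \<le> Y * e" "Y * e \<le> Y * (B * e)" "z \<le> Y * z"
    using mult_right_mono[OF B(1) e] mult_right_mono[OF Y(1), of "B * e"] mult_right_mono[OF Y(1) e]
      mult_right_mono[OF Y(1) z] mult_left_mono[OF mult_right_mono[OF B(1) e], of Y] B Y e
    by simp_all
  then have "e \<le> Y * (B * e)" by linarith
  have "\<bar>prob (no_hit N) - exp (- ((1 - \<rho>) * t))\<bar>
      \<le> 4 * (B * e) + t * (5 * (Y * (B * e)) + 5 * (B * e) + 72 * z) + t * e + e + t * (Y * e)"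
  proof -
    have "5 * B * (Y * e + e) + 72 * z = 5 * (Y * (B * e)) + 5 * (B * e) + 72 * z"
      "Y * e * t = t * (Y * e)"
      by (simp_all add: algebra_simps)
    then show ?thesis
      using 1 2 3 4 by (simp only: mult.assoc[of 4])
  qed
  also have "\<dots> \<le> 4 * (Y * (B * e)) + t * (5 * (Y * (B * e)) + 5 * (Y * (B * e)) + 72 * (Y * z))
      + t * (Y * (B * e)) + Y * (B * e) + t * (Y * (B * e))"
    using Be \<open>e \<le> Y * (B * e)\<close> t B Y by (intro add_mono mult_left_mono) auto
  \<comment> \<open>The coefficients are 4 + 1 without \<open>t\<close> and 5 + 5 + 1 + 1 with it;
    both totals are below 20.\<close>
  also have "\<dots> = (5 + 12 * t) * (Y * (B * e)) + t * (72 * (Y * z))"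
    by (simp add: algebra_simps)
  also have "\<dots> \<le> ((t + 1) * 20) * (Y * (B * e)) + (t + 1) * (72 * (Y * z))"
    using t Y B e z by (intro add_mono mult_right_mono) auto
  also have "\<dots> = (t + 1) * Y * (20 * (real l)\<^sup>2 * real (d l) * real n * e + 72 * real l * psi M n)"
    by (simp add: B_def z_def algebra_simps)
  finally show ?thesis by (simp only: N_def Y_def e_def mult_minus_left)
qed

end

section \<open>Comparison with the stated constants\<close>

theorem corollary2p6:
  fixes M :: "(nat \<Rightarrow> 'a :: countable) measure"
    and l n :: nat and d :: "nat \<Rightarrow> nat"
    and a :: "'a list" and A :: "(nat \<Rightarrow> 'a) set" and \<Gamma> t :: real
  assumes alphabet: "\<exists>x y :: 'a. x \<noteq> y"
    and prob: "prob_space M"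
    and sets: "sets M = sigma_sets UNIV (\<Union>m. cylinders m)"
    and invariant: "\<And>B. B \<in> sets M \<Longrightarrow> measure M (shift -` B) = measure M B"
    and positive: "\<And>x. measure M (cylinder [x]) > 0"
    and l: "1 \<le> l"
    and d: "1 \<le> d 1" "strict_mono_on {1..l} d"
    and mixing: "psi_mixing M"
    and Gamma: "\<Gamma> > 0"
      "\<And>m B. 1 \<le> m \<Longrightarrow> B \<in> cylinders m \<Longrightarrow> measure M B \<le> exp (- \<Gamma> * real m)"
    and n: "1 \<le> n"
    and A: "length a = n" "A = cylinder a" "measure M A > 0"
    and t: "0 \<le> t"
    and psi_n: "psi M n < (3 / 2) powr (1 / (real l + 1)) - 1"
  shows "ereal \<bar>measure M {\<omega> \<in> space M.
              ereal (measure M A ^ l) * ereal_of_enat (hitting_time l d A \<omega>) > ereal t}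
            - exp (- (1 - rho M l d a) * t)\<bar>
    \<le> (if t = 0 then \<infinity> else ereal
        (2 ^ (2 * l + 8) * (1 + psi M 0) ^ (2 * l) * (t + 1) *
           (psi M n * inverse (1 - exp (- \<Gamma>))
            + real (d l) * (real l)\<^sup>2 * real n ^ 4 * (1 + inverse t)
              * exp (- \<Gamma> * real n / (real (d l) + 6)))
         + 2 * wp (2 ^ l * t * psi M n
            + 10 * exp (- \<Gamma> * real n / 2) * (1 + psi M 0) ^ (2 * l)
              * real (d l) * (real n)\<^sup>2 * (t + 1))))"
proof (cases "t = 0")
  case False
  then have t_pos: "0 < t" using t by simp
  interpret psi_mixing_shift M
    using prob sets invariant mixing by (intro psi_mixing_shift.intro psi_mixing_shift_axioms.intro)
  have small: "(1 + psi M n) ^ (l + 1) < 3 / 2"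
  proof -
    have "(1 + psi M n) ^ (l + 1) < ((3 / 2) powr (1 / (real l + 1))) ^ (l + 1)"
      using psi_n psi_nonneg[of n] by (intro power_strict_mono) auto
    also have "\<dots> = 3 / 2"
      by (subst powr_power) (auto simp: add.commute)
    finally show ?thesis .
  qed
  interpret R: multiple_recurrence M l d a \<Gamma>
  proof
    show "prob (cylinder w) \<le> exp (- \<Gamma> * real (length w))" if "w \<noteq> []" for w
      using that by (intro Gamma(2)) (auto simp: cylinders_def Suc_le_eq)
  qed (use l d A n Gamma(1) small in auto)
  have R: "R.n = n" "R.p = prob A" "R.\<rho> = rho M l d a"
    by (simp_all add: R.n_def R.p_def R.\<rho>_def A)
  define Y where "Y = (1 + psi M 0) ^ (2 * l)"
  define Q where "Q = exp (- \<Gamma> * real n / (real (d l) + 6))"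
  define e where "e = exp (- \<Gamma> * real n / 2)"
  define B where "B = real (d l) * (real l)\<^sup>2"
  \<comment> \<open>\<open>l + 1 \<le> 2 * l\<close> because \<open>l \<ge> 1\<close>.\<close>
  have Y: "1 \<le> Y" "(1 + psi M 0) ^ (l + 1) \<le> Y"
    unfolding Y_def using psi_nonneg[of 0] l by (simp, intro power_increasing) simp_all
  have "\<Gamma> * real n / (real (d l) + 6) \<le> \<Gamma> * real n / 2"
    using Gamma(1) by (intro divide_left_mono) auto
  then have eQ: "e \<le> Q" by (simp add: e_def Q_def)
  \<comment> \<open>\<open>l \<le> 2 ^ l \<le> 2 ^ (2 * l)\<close>, and
    \<open>72 \<le> 2 ^ 8\<close> supplies the rest.\<close>
  have l2: "72 * real l \<le> 2 ^ (2 * l + 8)"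
  proof -
    have "real l \<le> 2 ^ l" using of_nat_less_two_power[of l, where 'a = real] by simp
    also have "\<dots> \<le> 2 ^ (2 * l)" by (intro power_increasing) auto
    finally have "72 * real l \<le> 256 * 2 ^ (2 * l)" by linarith
    then show ?thesis by (simp add: power_add)
  qed
  have c2: "(20::real) \<le> 2 ^ (2 * l + 8)"
    using power_increasing[of 8 "2 * l + 8" "2 :: real"] by simp
  have "0 < 1 - exp (- \<Gamma>)" "1 - exp (- \<Gamma>) \<le> 1" using Gamma(1) by auto
  then have inv: "1 \<le> inverse (1 - exp (- \<Gamma>))"
    by (simp add: one_le_inverse)
  have n4: "real n \<le> real n ^ 4" using n self_le_power[of "real n" 4] by simp
  have "\<bar>prob {\<omega> \<in> space M. ereal (prob A ^ l) * ereal_of_enat (hitting_time l d A \<omega>) > ereal t}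
      - exp (- (1 - rho M l d a) * t)\<bar>
    \<le> (t + 1) * (1 + psi M 0) ^ (l + 1) * (20 * (real l)\<^sup>2 * real (d l) * real n * e + 72 * real l * psi M n)"
    using R.hitting_time_error[OF t] R.no_hit_hitting_time[OF t] unfolding R e_def by (simp add: A)
  \<comment> \<open>Termwise: \<open>e \<le> Q\<close>, \<open>n \<le> n ^ 4\<close> and
    \<open>1 \<le> 1 + inverse t\<close> in the exponential term,
    \<open>1 \<le> inverse (1 - exp (- \<Gamma>))\<close> in the mixing term.\<close>
  also have "\<dots> \<le> (t + 1) * Y * (2 ^ (2 * l + 8) * (B * real n ^ 4 * (1 + inverse t) * Q)
      + 2 ^ (2 * l + 8) * (psi M n * inverse (1 - exp (- \<Gamma>))))"
  proof -
    have "20 * (real l)\<^sup>2 * real (d l) * real n * e = 20 * (B * real n * 1 * e)"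
      by (simp add: B_def)
    also have "\<dots> \<le> 2 ^ (2 * l + 8) * (B * real n ^ 4 * (1 + inverse t) * Q)"
      using c2 n4 t_pos eQ by (intro mult_mono mult_left_mono) (auto simp: B_def e_def)
    finally have 1: "20 * (real l)\<^sup>2 * real (d l) * real n * e
      \<le> 2 ^ (2 * l + 8) * (B * real n ^ 4 * (1 + inverse t) * Q)" .
    have "72 * real l * (psi M n * 1) \<le> 2 ^ (2 * l + 8) * (psi M n * inverse (1 - exp (- \<Gamma>)))"
      using l2 inv psi_nonneg[of n] by (intro mult_mono mult_left_mono) auto
    then have 2: "72 * real l * psi M n \<le> 2 ^ (2 * l + 8) * (psi M n * inverse (1 - exp (- \<Gamma>)))"
      by simp
    show ?thesis
      by (rule mult_mono[OF mult_left_mono add_mono[OF 1 2]])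
        (use t Y psi_nonneg in \<open>auto simp: e_def\<close>)
  qed
  also have "\<dots> = 2 ^ (2 * l + 8) * Y * (t + 1) * (psi M n * inverse (1 - exp (- \<Gamma>))
      + real (d l) * (real l)\<^sup>2 * real n ^ 4 * (1 + inverse t) * Q)"
    by (simp add: B_def algebra_simps)
  \<comment> \<open>The argument of \<open>wp\<close> is nonnegative, so the added summand is
    too.\<close>
  also have "\<dots> \<le> \<dots> + 2 * wp (2 ^ l * t * psi M n
      + 10 * e * Y * real (d l) * (real n)\<^sup>2 * (t + 1))"
    using t psi_nonneg Y by (simp add: wp_def e_def)
  finally show ?thesis
    using False by (simp add: Y_def Q_def e_def)
qed simp

end
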